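(* Let $X=I\sqcup J$ be a finite set and let $\pi$ be an $X$-indexed noncrossing partition. Put $$\Delta_{I,J}(\pi)=\begin{cases}\pi_{\mid I}\otimes \pi_{\mid_\cdot J}&\text{if } J \text{ is an ideal of }\pi,\\ 0&\text{otherwise,}\end{cases}$$ an element of $\mathbf{A}[I]\otimes \mathbf{A}[J]$, where $\mathbf{A}=\mathbf{Com}\circ\mathbf{NCP}$. Extend $\Delta$ as a (twisted) algebra morphism from $\mathbf{A}$ to $\mathbf{A}\otimes\mathbf{A}$, i.e. $\Delta_{I,J}(\pi_1\cdot\ldots\cdot\pi_k)=\prod_{i}\Delta_{I\cap X_i,J\cap X_i}(\pi_i)$ whenever $\pi_i$ is $X_i$-indexed and $X_1\sqcup\ldots\sqcup X_k=I\sqcup J$. Then $(\mathbf{A},m,\Delta)$, where $m$ is the product $\cdot$ of $\mathbf{A}$, is a twisted bialgebra.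
   Context: $\mathbb{K}$ is a field of characteristic zero and $[n]=\{1,\ldots,n\}$. Noncrossing partitions. A noncrossing partition is a partition $\pi$ of a set $[n]$, $n\ge 1$, into nonempty blocks such that there are no distinct blocks $b\ne b'$ and $x,z\in b$, $y,t\in b'$ with $x<y<z<t$. For a finite set $X$, an $X$-indexed noncrossing partition is a noncrossing partition with $|X|$ blocks together with a bijection between its blocks and $X$; it is written $\pi=(\pi_x)_{x\in X}$, $\pi_x$ being the block indexed by $x$. There is none for $X=\emptyset$. Bijections $X\to Y$ act by relabelling. The species $\mathbf{A}=\mathbf{Com}\circ\mathbf{NCP}$. For a finite set $X$, $\mathbf{A}[X]$ is the vector space with basis the commutative monomials $\pi_1\cdot\ldots\cdot\pi_k$, where $\{X_1,\ldots,X_k\}$ is a partition of $X$ into nonempty sets and $\pi_i$ is an $X_i$-indexed noncrossing partition; $\mathbf{A}[\emptyset]=\mathbb{K}1$, with $1$ the empty monomial. The product $m_{X,Y}:\mathbf{A}[X]\otimes \mathbf{A}[Y]\to \mathbf{A}[X\sqcup Y]$ is concatenation of commutative monomials, denoted by $\cdot$; its unit is $1$. Restrictions and ideals. For $\pi=(\pi_x)_{x\in X}$ a noncrossing partition of $[n]$ and $Y\subseteq X$ nonempty, $\pi_{\mid Y}$ is the $Y$-indexed noncrossing partition obtained by deleting the blocks not indexed by $Y$ and renumbering the remaining elements by the increasing bijection onto an initial segment; $\pi_{\mid\emptyset}=1$. For $I\subseteq X$ write $I'=\bigcup_{x\in I}\pi_x\subseteq[n]$ as the disjoint union of its connected components $I'_1\sqcup\ldots\sqcup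 I'_k$, i.e. of its maximal subsets of consecutive integers. $I$ is an ideal of $\pi$ if each $I'_i$ is a union of blocks of $\pi$. In this case $\pi_{\mid_\cdot I}=\prod_{i=1}^k\pi_{\mid I_i}\in\mathbf{A}[I]$ (product $\cdot$), where $I_i\subseteq I$ is the set of indices of the blocks contained in $I_i'$ (the empty product being $1$). Twisted bialgebras. A (linear) species is a functor $\mathbf{P}$ from finite sets with bijections to vector spaces. A twisted bialgebra is a bialgebra in the symmetric monoidal category of species with the Cauchy tensor product $(\mathbf{P}\otimes\mathbf{Q})[X]=\bigoplus_{X=Y\sqcup Z}\mathbf{P}[Y]\otimes\mathbf{Q}[Z]$ (with the usual flip). Concretely, it is a species $\mathbf{P}$ with linear maps $m_{X,Y}:\mathbf{P}[X]\otimes\mathbf{P}[Y]\to\mathbf{P}[X\sqcup Y]$ and $\Delta_{X,Y}:\mathbf{P}[X\sqcup Y]\to\mathbf{P}[X]\otimes\mathbf{P}[Y]$, for disjoint finite sets $X,Y$, natural in bijections, such that: $m$ is associative with a unit $1\in\mathbf{P}[\emptyset]$; $\Delta$ is coassociative, $(\Delta_{X,Y}\otimes\mathrm{Id})\circ\Delta_{X\sqcup Y,Z}=(\mathrm{Id}\otimes\Delta_{Y,Z})\circ\Delta_{X,Y\sqcup Z}$, with a counit $\varepsilon_\Delta\in\mathbf{P}[\emptyset]^*$, $(\varepsilon_\Delta\otimes\mathrm{Id})\circ\Delta_{\emptyset,X}=\mathrm{Id}=(\mathrm{Id}\otimes\varepsilon_\Delta)\circ\Delta_{X,\emptyset}$;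 if $X_1\sqcup X_2=Y_1\sqcup Y_2$ then $\Delta_{Y_1,Y_2}\circ m_{X_1,X_2}=(m_{X_1\cap Y_1,X_2\cap Y_1}\otimes m_{X_1\cap Y_2,X_2\cap Y_2})\circ(\mathrm{Id}\otimes c\otimes\mathrm{Id})\circ(\Delta_{X_1\cap Y_1,X_1\cap Y_2}\otimes\Delta_{X_2\cap Y_1,X_2\cap Y_2})$ with $c$ the flip; $\varepsilon_\Delta$ is multiplicative on $\mathbf{P}[\emptyset]$; $\Delta_{\emptyset,\emptyset}(1)=1\otimes1$ and $\varepsilon_\Delta(1)=1$. *)

theory Defs
  imports
    Complex_Main
    "HOL-Library.Poly_Mapping"
    "HOL-Library.Product_Plus"
    "HOL-Library.Multiset"
    "HOL-Library.Disjoint_Sets"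
begin

section \<open>Vector spaces with a basis and their tensor products\<close>

text \<open>
  Vector spaces are given together with a basis: the space with basis \<open>A\<close> is the space of finitely
  supported functions on \<open>A\<close> (every vector space is of this form). Linear maps are arbitrary and need
  not respect the bases. The tensor product of the spaces with bases \<open>A\<close> and \<open>B\<close> is the space with
  basis \<open>A \<times> B\<close>; its universal property is \<open>tensor_universal\<close> below.
\<close>

definition fscale :: "'k::field \<Rightarrow> ('a \<Rightarrow>\<^sub>0 'k) \<Rightarrow> ('a \<Rightarrow>\<^sub>0 'k)" where
  "fscale c v = Poly_Mapping.map ((*) c) v"

definition fspace :: "'a set \<Rightarrow> ('a \<Rightarrow>\<^sub>0 'k::field) set" where
  "fspace A = {v. Poly_Mapping.keys v \<subseteq> A}"

abbreviation basis_vec :: "'a \<Rightarrow> ('a \<Rightarrow>\<^sub>0 'k::field)" where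
  "basis_vec a \<equiv> Poly_Mapping.single a 1"

definition linear_on ::
  "'a set \<Rightarrow> 'b set \<Rightarrow> (('a \<Rightarrow>\<^sub>0 'k::field) \<Rightarrow> ('b \<Rightarrow>\<^sub>0 'k)) \<Rightarrow> bool" where
  "linear_on A B f \<longleftrightarrow>
     (\<forall>u\<in>fspace A. f u \<in> fspace B) \<and>
     (\<forall>u\<in>fspace A. \<forall>v\<in>fspace A. f (u + v) = f u + f v) \<and>
     (\<forall>c. \<forall>u\<in>fspace A. f (fscale c u) = fscale c (f u))"

definition linear_form_on :: "'a set \<Rightarrow> (('a \<Rightarrow>\<^sub>0 'k::field) \<Rightarrow> 'k) \<Rightarrow> bool" where
  "linear_form_on A f \<longleftrightarrow>
     (\<forall>u\<in>fspace A. \<forall>v\<in>fspace A. f (u + v) = f u + f v) \<and>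
     (\<forall>c. \<forall>u\<in>fspace A. f (fscale c u) = c * f u)"

definition lin_ext :: "('a \<Rightarrow> ('b \<Rightarrow>\<^sub>0 'k::field)) \<Rightarrow> ('a \<Rightarrow>\<^sub>0 'k) \<Rightarrow> ('b \<Rightarrow>\<^sub>0 'k)" where
  "lin_ext f v = (\<Sum>a\<in>Poly_Mapping.keys v. fscale (Poly_Mapping.lookup v a) (f a))"

definition tensor ::
  "('a \<Rightarrow>\<^sub>0 'k::field) \<Rightarrow> ('b \<Rightarrow>\<^sub>0 'k) \<Rightarrow> ('a \<times> 'b \<Rightarrow>\<^sub>0 'k)" (infixr "\<otimes>\<^sub>v" 75) where
  "u \<otimes>\<^sub>v v = (\<Sum>a\<in>Poly_Mapping.keys u. \<Sum>b\<in>Poly_Mapping.keys v.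
     Poly_Mapping.single (a, b) (Poly_Mapping.lookup u a * Poly_Mapping.lookup v b))"

definition tensor_map ::
  "(('a \<Rightarrow>\<^sub>0 'k::field) \<Rightarrow> ('c \<Rightarrow>\<^sub>0 'k)) \<Rightarrow> (('b \<Rightarrow>\<^sub>0 'k) \<Rightarrow> ('d \<Rightarrow>\<^sub>0 'k))
    \<Rightarrow> ('a \<times> 'b \<Rightarrow>\<^sub>0 'k) \<Rightarrow> ('c \<times> 'd \<Rightarrow>\<^sub>0 'k)" where
  "tensor_map f g = lin_ext (\<lambda>(a, b). f (basis_vec a) \<otimes>\<^sub>v g (basis_vec b))"

text \<open>The canonical map from \<open>(U \<otimes> V) \<otimes> W\<close> to \<open>U \<otimes> (V \<otimes> W)\<close>.\<close>

definition tensor_assoc ::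
  "(('a \<times> 'b) \<times> 'c \<Rightarrow>\<^sub>0 'k::field) \<Rightarrow> ('a \<times> 'b \<times> 'c \<Rightarrow>\<^sub>0 'k)" where
  "tensor_assoc = lin_ext (\<lambda>((a, b), c). basis_vec (a, b, c))"

text \<open>The map \<open>Id \<otimes> c \<otimes> Id\<close>, where \<open>c\<close> is the flip.\<close>

definition tensor_middle_flip ::
  "(('a \<times> 'b) \<times> ('c \<times> 'd) \<Rightarrow>\<^sub>0 'k::field) \<Rightarrow> (('a \<times> 'c) \<times> ('b \<times> 'd) \<Rightarrow>\<^sub>0 'k)" where
  "tensor_middle_flip = lin_ext (\<lambda>((a, b), (c, d)). basis_vec ((a, c), (b, d)))"

text \<open>For a linear form \<open>e\<close>, the maps \<open>e \<otimes> Id\<close> and \<open>Id \<otimes> e\<close>, where \<open>K \<otimes> V\<close> and \<open>V \<otimes> K\<close> are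
  identified with \<open>V\<close>.\<close>

definition form_tensor_id ::
  "(('a \<Rightarrow>\<^sub>0 'k::field) \<Rightarrow> 'k) \<Rightarrow> ('a \<times> 'b \<Rightarrow>\<^sub>0 'k) \<Rightarrow> ('b \<Rightarrow>\<^sub>0 'k)" where
  "form_tensor_id e = lin_ext (\<lambda>(a, b). fscale (e (basis_vec a)) (basis_vec b))"

definition id_tensor_form ::
  "(('b \<Rightarrow>\<^sub>0 'k::field) \<Rightarrow> 'k) \<Rightarrow> ('a \<times> 'b \<Rightarrow>\<^sub>0 'k) \<Rightarrow> ('a \<Rightarrow>\<^sub>0 'k)" where
  "id_tensor_form e = lin_ext (\<lambda>(a, b). fscale (e (basis_vec b)) (basis_vec a))"

lemma lookup_fscale [simp]:
  "Poly_Mapping.lookup (fscale c v) a = c * Poly_Mapping.lookup v a"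
  by (simp add: fscale_def map.rep_eq when_def)

lemma vector_space_fscale: "vector_space (fscale :: 'k::field \<Rightarrow> ('a \<Rightarrow>\<^sub>0 'k) \<Rightarrow> _)"
  unfolding vector_space_def
  by (intro conjI allI; rule poly_mapping_eqI; simp add: lookup_add algebra_simps)

lemma fscale_single [simp]:
  "fscale c (Poly_Mapping.single a d) = Poly_Mapping.single a (c * d)"
  by (rule poly_mapping_eqI) (simp add: lookup_single when_def)

lemma fspace_0 [simp]: "0 \<in> fspace A"
  by (simp add: fspace_def)

lemma fspace_add: "u \<in> fspace A \<Longrightarrow> v \<in> fspace A \<Longrightarrow> u + v \<in> fspace A"
  using keys_add unfolding fspace_def by fastforce

lemma fspace_scale: "u \<in> fspace A \<Longrightarrow> fscale c u \<in> fspace A"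
  by (auto simp: fspace_def in_keys_iff subset_iff)

lemma fspace_sum: "(\<And>i. i \<in> S \<Longrightarrow> f i \<in> fspace A) \<Longrightarrow> sum f S \<in> fspace A"
  by (induction S rule: infinite_finite_induct) (auto intro: fspace_add)

lemma basis_vec_in_fspace: "a \<in> A \<Longrightarrow> basis_vec a \<in> fspace A"
  by (simp add: fspace_def)

lemma linear_on_0: "linear_on A B f \<Longrightarrow> f 0 = 0"
  unfolding linear_on_def using fspace_0 by (metis add_cancel_right_right)

lemma linear_on_sum:
  assumes f: "linear_on A B f" and g: "\<And>i. i \<in> S \<Longrightarrow> g i \<in> fspace A"
  shows "f (sum g S) = (\<Sum>i\<in>S. f (g i))"
  using g
proof (induction S rule: infinite_finite_induct)
  case (insert x S)
  then show ?case
    using f fspace_sum[of S g A] by (simp add: linear_on_def)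
qed (auto simp: linear_on_0[OF f])

lemma basis_expansion:
  "v = (\<Sum>a\<in>Poly_Mapping.keys v. fscale (Poly_Mapping.lookup v a) (basis_vec a))"
proof (rule poly_mapping_eqI)
  fix b
  show "Poly_Mapping.lookup v b = Poly_Mapping.lookup
      (\<Sum>a\<in>Poly_Mapping.keys v. fscale (Poly_Mapping.lookup v a) (basis_vec a)) b"
    by (simp add: lookup_sum lookup_single when_def in_keys_iff)
qed

lemma linear_on_expansion:
  assumes f: "linear_on A B f" and v: "v \<in> fspace A"
  shows "f v = lin_ext (\<lambda>a. f (basis_vec a)) v"
proof -
  have A: "basis_vec a \<in> fspace A" if "a \<in> Poly_Mapping.keys v" for a
    using that v by (auto intro: basis_vec_in_fspace simp: fspace_def)
  have "f v = (\<Sum>a\<in>Poly_Mapping.keys v. f (fscale (Poly_Mapping.lookup v a) (basis_vec a)))"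
    by (subst basis_expansion[of v], rule linear_on_sum[OF f])
      (use A in \<open>blast intro: fspace_scale\<close>)
  also have "\<dots> = lin_ext (\<lambda>a. f (basis_vec a)) v"
    unfolding lin_ext_def using f A unfolding linear_on_def by (intro sum.cong refl) blast
  finally show ?thesis .
qed

lemma lin_ext_basis_vec [simp]: "lin_ext f (basis_vec a) = f a"
  by (auto simp: lin_ext_def intro: poly_mapping_eqI)

lemma lin_ext_superset:
  assumes "finite S" "Poly_Mapping.keys v \<subseteq> S"
  shows "lin_ext f v = (\<Sum>a\<in>S. fscale (Poly_Mapping.lookup v a) (f a))"
  unfolding lin_ext_def
  by (rule sum.mono_neutral_left[OF assms])
    (auto simp: in_keys_iff intro!: poly_mapping_eqI)

lemma lin_ext_add:
  fixes f :: "'a \<Rightarrow> ('b \<Rightarrow>\<^sub>0 'k::field)"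
  shows "lin_ext f (u + v) = lin_ext f u + lin_ext f v"
proof -
  let ?S = "Poly_Mapping.keys u \<union> Poly_Mapping.keys v"
  have "fscale (c + d) w = fscale c w + fscale d w" for c d :: 'k and w :: "'b \<Rightarrow>\<^sub>0 'k"
    by (rule poly_mapping_eqI) (simp add: lookup_add algebra_simps)
  then show ?thesis
    using keys_add[of u v]
    by (simp add: lin_ext_superset[of ?S] lookup_add sum.distrib[symmetric])
qed

lemma lin_ext_scale: "lin_ext f (fscale c u) = fscale c (lin_ext f u)"
proof -
  have "Poly_Mapping.keys (fscale c u) \<subseteq> Poly_Mapping.keys u"
    by (auto simp: in_keys_iff)
  then show ?thesis
    by (subst (1 2) lin_ext_superset[of "Poly_Mapping.keys u"])
      (auto intro!: poly_mapping_eqI simp: lookup_sum sum_distrib_left algebra_simps)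
qed

lemma linear_on_lin_ext:
  "(\<And>a. a \<in> A \<Longrightarrow> f a \<in> fspace B) \<Longrightarrow> linear_on A B (lin_ext f)"
  unfolding linear_on_def
  by (auto simp: lin_ext_add lin_ext_scale)
     (auto simp: lin_ext_def fspace_def[of A] intro!: fspace_sum fspace_scale)

lemma lookup_tensor [simp]:
  "Poly_Mapping.lookup (u \<otimes>\<^sub>v v) (a, b) = Poly_Mapping.lookup u a * Poly_Mapping.lookup v b"
proof -
  have "Poly_Mapping.lookup (u \<otimes>\<^sub>v v) (a, b) =
      (\<Sum>a'\<in>Poly_Mapping.keys u. \<Sum>b'\<in>Poly_Mapping.keys v.
        if a' = a then if b' = b then Poly_Mapping.lookup u a * Poly_Mapping.lookup v b else 0 else 0)"
    unfolding tensor_def lookup_sum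
    by (intro sum.cong refl) (auto simp: lookup_single when_def)
  also have "\<dots> = Poly_Mapping.lookup u a * Poly_Mapping.lookup v b"
  proof -
    have "(\<Sum>b'\<in>Poly_Mapping.keys v.
        if a' = a then if b' = b then Poly_Mapping.lookup u a * Poly_Mapping.lookup v b else 0 else 0)
      = (if a' = a then Poly_Mapping.lookup u a * Poly_Mapping.lookup v b else 0)" for a'
      by (cases "a' = a") (auto simp: in_keys_iff)
    then show ?thesis
      by (auto simp: in_keys_iff)
  qed
  finally show ?thesis .
qed

lemma tensor_in_fspace:
  "u \<in> fspace A \<Longrightarrow> v \<in> fspace B \<Longrightarrow> u \<otimes>\<^sub>v v \<in> fspace (A \<times> B)"
  by (auto simp: fspace_def in_keys_iff subset_iff)

lemma tensor_basis_vec [simp]: "basis_vec a \<otimes>\<^sub>v basis_vec b = basis_vec (a, b)"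
  by (rule poly_mapping_eqI) (auto simp: lookup_single when_def split: prod.splits if_splits)

theorem tensor_universal:
  fixes \<beta> :: "('a \<Rightarrow>\<^sub>0 'k::field) \<Rightarrow> ('b \<Rightarrow>\<^sub>0 'k) \<Rightarrow> ('c \<Rightarrow>\<^sub>0 'k)"
  assumes l: "\<And>v. v \<in> fspace B \<Longrightarrow> linear_on A C (\<lambda>u. \<beta> u v)"
    and r: "\<And>u. u \<in> fspace A \<Longrightarrow> linear_on B C (\<beta> u)"
  shows "\<exists>h. linear_on (A \<times> B) C h \<and> (\<forall>u\<in>fspace A. \<forall>v\<in>fspace B. h (u \<otimes>\<^sub>v v) = \<beta> u v) \<and>
    (\<forall>h'. linear_on (A \<times> B) C h' \<and> (\<forall>u\<in>fspace A. \<forall>v\<in>fspace B. h' (u \<otimes>\<^sub>v v) = \<beta> u v) \<longrightarrow>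
       (\<forall>t\<in>fspace (A \<times> B). h' t = h t))"
proof -
  define h where "h = lin_ext (\<lambda>(a, b). \<beta> (basis_vec a) (basis_vec b))"
  have lin: "linear_on (A \<times> B) C h"
    unfolding h_def
    by (rule linear_on_lin_ext)
      (use r in \<open>auto simp: linear_on_def basis_vec_in_fspace\<close>)
  have "h (u \<otimes>\<^sub>v v) = \<beta> u v" if u: "u \<in> fspace A" and v: "v \<in> fspace B" for u v
  proof -
    have ua: "basis_vec a \<in> fspace A" if "a \<in> Poly_Mapping.keys u" for a
      using that u by (auto intro: basis_vec_in_fspace simp: fspace_def)
    have sub: "Poly_Mapping.keys (u \<otimes>\<^sub>v v) \<subseteq> Poly_Mapping.keys u \<times> Poly_Mapping.keys v"
      by (auto simp: in_keys_iff)
    have "\<beta> u v = (\<Sum>a\<in>Poly_Mapping.keys u. fscale (Poly_Mapping.lookup u a) (\<beta> (basis_vec a) v))"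
      using linear_on_expansion[OF l[OF v] u] by (simp add: lin_ext_def)
    also have "\<dots> = (\<Sum>a\<in>Poly_Mapping.keys u. fscale (Poly_Mapping.lookup u a)
        (\<Sum>b\<in>Poly_Mapping.keys v. fscale (Poly_Mapping.lookup v b) (\<beta> (basis_vec a) (basis_vec b))))"
      by (intro sum.cong refl arg_cong2[of _ _ _ _ fscale])
        (use linear_on_expansion[OF r[OF ua] v] in \<open>simp add: lin_ext_def\<close>)
    also have "\<dots> = h (u \<otimes>\<^sub>v v)"
      unfolding h_def
      by (subst lin_ext_superset[OF _ sub])
        (auto intro!: poly_mapping_eqI
          simp: lookup_sum sum_distrib_left mult.assoc sum.cartesian_product intro!: sum.cong)
    finally show ?thesis ..
  qed
  moreover have "h' t = h t" if h': "linear_on (A \<times> B) C h'"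
      and eq: "\<forall>u\<in>fspace A. \<forall>v\<in>fspace B. h' (u \<otimes>\<^sub>v v) = \<beta> u v"
      and t: "t \<in> fspace (A \<times> B)" for h' t
  proof -
    have "h' (basis_vec p) = (case p of (a, b) \<Rightarrow> \<beta> (basis_vec a) (basis_vec b))"
      if "p \<in> Poly_Mapping.keys t" for p
      using that t eq by (cases p) (auto simp: fspace_def tensor_basis_vec[symmetric]
          simp del: tensor_basis_vec)
    then show ?thesis
      using linear_on_expansion[OF h' t] by (simp add: h_def lin_ext_def)
  qed
  ultimately show ?thesis
    using lin by (intro exI[of _ h]) blast
qed


section \<open>Species and twisted bialgebras\<close>

text \<open>
  The finite sets are the finite sets of elements of an arbitrary type \<open>'x\<close>. The space \<open>P[X]\<close> is
  \<open>fspace (B X)\<close>. A bijection from \<open>X\<close> to \<open>Y\<close> is a function \<open>\<sigma> :: 'x \<Rightarrow> 'x\<close> that is injective on \<open>X\<close>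
  with \<open>\<sigma> ` X = Y\<close>; its values outside \<open>X\<close> are irrelevant (\<open>act_cong\<close>).
\<close>

locale linear_species =
  fixes B :: "'x set \<Rightarrow> 'b set"
    and act :: "'x set \<Rightarrow> ('x \<Rightarrow> 'x) \<Rightarrow> ('b \<Rightarrow>\<^sub>0 'k::field) \<Rightarrow> ('b \<Rightarrow>\<^sub>0 'k)"
  assumes act_linear:
      "\<And>X \<sigma>. finite X \<Longrightarrow> inj_on \<sigma> X \<Longrightarrow> linear_on (B X) (B (\<sigma> ` X)) (act X \<sigma>)"
    and act_cong:
      "\<And>X \<sigma> \<tau> v. finite X \<Longrightarrow> inj_on \<sigma> X \<Longrightarrow> (\<And>x. x \<in> X \<Longrightarrow> \<sigma> x = \<tau> x) \<Longrightarrow> v \<in> fspace (B X)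
        \<Longrightarrow> act X \<sigma> v = act X \<tau> v"
    and act_id: "\<And>X v. finite X \<Longrightarrow> v \<in> fspace (B X) \<Longrightarrow> act X id v = v"
    and act_comp:
      "\<And>X \<sigma> \<tau> v. finite X \<Longrightarrow> inj_on \<sigma> X \<Longrightarrow> inj_on \<tau> (\<sigma> ` X) \<Longrightarrow> v \<in> fspace (B X)
        \<Longrightarrow> act X (\<tau> \<circ> \<sigma>) v = act (\<sigma> ` X) \<tau> (act X \<sigma> v)"

locale twisted_algebra = linear_species B act
  for B :: "'x set \<Rightarrow> 'b set"
    and act :: "'x set \<Rightarrow> ('x \<Rightarrow> 'x) \<Rightarrow> ('b \<Rightarrow>\<^sub>0 'k::field) \<Rightarrow> ('b \<Rightarrow>\<^sub>0 'k)" +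
  fixes m :: "'x set \<Rightarrow> 'x set \<Rightarrow> ('b \<times> 'b \<Rightarrow>\<^sub>0 'k) \<Rightarrow> ('b \<Rightarrow>\<^sub>0 'k)"
    and one :: "'b \<Rightarrow>\<^sub>0 'k"
  assumes m_linear:
      "\<And>X Y. finite X \<Longrightarrow> finite Y \<Longrightarrow> X \<inter> Y = {} \<Longrightarrow> linear_on (B X \<times> B Y) (B (X \<union> Y)) (m X Y)"
    and m_natural:
      "\<And>X Y \<sigma> t. finite X \<Longrightarrow> finite Y \<Longrightarrow> X \<inter> Y = {} \<Longrightarrow> inj_on \<sigma> (X \<union> Y)
        \<Longrightarrow> t \<in> fspace (B X \<times> B Y)
        \<Longrightarrow> act (X \<union> Y) \<sigma> (m X Y t) = m (\<sigma> ` X) (\<sigma> ` Y) (tensor_map (act X \<sigma>) (act Y \<sigma>) t)"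
    and m_assoc:
      "\<And>X Y Z t. finite X \<Longrightarrow> finite Y \<Longrightarrow> finite Z
        \<Longrightarrow> X \<inter> Y = {} \<Longrightarrow> X \<inter> Z = {} \<Longrightarrow> Y \<inter> Z = {} \<Longrightarrow> t \<in> fspace ((B X \<times> B Y) \<times> B Z)
        \<Longrightarrow> m (X \<union> Y) Z (tensor_map (m X Y) id t)
           = m X (Y \<union> Z) (tensor_map id (m Y Z) (tensor_assoc t))"
    and one_in: "one \<in> fspace (B {})"
    and m_one_left: "\<And>X v. finite X \<Longrightarrow> v \<in> fspace (B X) \<Longrightarrow> m {} X (one \<otimes>\<^sub>v v) = v"
    and m_one_right: "\<And>X v. finite X \<Longrightarrow> v \<in> fspace (B X) \<Longrightarrow> m X {} (v \<otimes>\<^sub>v one) = v"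

locale twisted_coalgebra = linear_species B act
  for B :: "'x set \<Rightarrow> 'b set"
    and act :: "'x set \<Rightarrow> ('x \<Rightarrow> 'x) \<Rightarrow> ('b \<Rightarrow>\<^sub>0 'k::field) \<Rightarrow> ('b \<Rightarrow>\<^sub>0 'k)" +
  fixes \<Delta> :: "'x set \<Rightarrow> 'x set \<Rightarrow> ('b \<Rightarrow>\<^sub>0 'k) \<Rightarrow> ('b \<times> 'b \<Rightarrow>\<^sub>0 'k)"
    and \<epsilon> :: "('b \<Rightarrow>\<^sub>0 'k) \<Rightarrow> 'k"
  assumes \<Delta>_linear:
      "\<And>X Y. finite X \<Longrightarrow> finite Y \<Longrightarrow> X \<inter> Y = {} \<Longrightarrow> linear_on (B (X \<union> Y)) (B X \<times> B Y) (\<Delta> X Y)"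
    and \<Delta>_natural:
      "\<And>X Y \<sigma> v. finite X \<Longrightarrow> finite Y \<Longrightarrow> X \<inter> Y = {} \<Longrightarrow> inj_on \<sigma> (X \<union> Y)
        \<Longrightarrow> v \<in> fspace (B (X \<union> Y))
        \<Longrightarrow> \<Delta> (\<sigma> ` X) (\<sigma> ` Y) (act (X \<union> Y) \<sigma> v) = tensor_map (act X \<sigma>) (act Y \<sigma>) (\<Delta> X Y v)"
    and \<Delta>_coassoc:
      "\<And>X Y Z v. finite X \<Longrightarrow> finite Y \<Longrightarrow> finite Z
        \<Longrightarrow> X \<inter> Y = {} \<Longrightarrow> X \<inter> Z = {} \<Longrightarrow> Y \<inter> Z = {} \<Longrightarrow> v \<in> fspace (B (X \<union> Y \<union> Z))
        \<Longrightarrow> tensor_assoc (tensor_map (\<Delta> X Y) id (\<Delta> (X \<union> Y) Z v))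
           = tensor_map id (\<Delta> Y Z) (\<Delta> X (Y \<union> Z) v)"
    and \<epsilon>_linear: "linear_form_on (B {}) \<epsilon>"
    and counit_left: "\<And>X v. finite X \<Longrightarrow> v \<in> fspace (B X) \<Longrightarrow> form_tensor_id \<epsilon> (\<Delta> {} X v) = v"
    and counit_right: "\<And>X v. finite X \<Longrightarrow> v \<in> fspace (B X) \<Longrightarrow> id_tensor_form \<epsilon> (\<Delta> X {} v) = v"

locale twisted_bialgebra =
  twisted_algebra B act m one + twisted_coalgebra B act \<Delta> \<epsilon>
  for B :: "'x set \<Rightarrow> 'b set"
    and act :: "'x set \<Rightarrow> ('x \<Rightarrow> 'x) \<Rightarrow> ('b \<Rightarrow>\<^sub>0 'k::field) \<Rightarrow> ('b \<Rightarrow>\<^sub>0 'k)"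
    and m :: "'x set \<Rightarrow> 'x set \<Rightarrow> ('b \<times> 'b \<Rightarrow>\<^sub>0 'k) \<Rightarrow> ('b \<Rightarrow>\<^sub>0 'k)"
    and one :: "'b \<Rightarrow>\<^sub>0 'k"
    and \<Delta> :: "'x set \<Rightarrow> 'x set \<Rightarrow> ('b \<Rightarrow>\<^sub>0 'k) \<Rightarrow> ('b \<times> 'b \<Rightarrow>\<^sub>0 'k)"
    and \<epsilon> :: "('b \<Rightarrow>\<^sub>0 'k) \<Rightarrow> 'k" +
  assumes \<Delta>_m:
      "\<And>X1 X2 Y1 Y2 t. finite X1 \<Longrightarrow> finite X2 \<Longrightarrow> X1 \<inter> X2 = {} \<Longrightarrow> Y1 \<inter> Y2 = {}
        \<Longrightarrow> X1 \<union> X2 = Y1 \<union> Y2 \<Longrightarrow> t \<in> fspace (B X1 \<times> B X2)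
        \<Longrightarrow> \<Delta> Y1 Y2 (m X1 X2 t)
           = tensor_map (m (X1 \<inter> Y1) (X2 \<inter> Y1)) (m (X1 \<inter> Y2) (X2 \<inter> Y2))
               (tensor_middle_flip
                 (tensor_map (\<Delta> (X1 \<inter> Y1) (X1 \<inter> Y2)) (\<Delta> (X2 \<inter> Y1) (X2 \<inter> Y2)) t))"
    and \<epsilon>_m: "\<And>u v. u \<in> fspace (B {}) \<Longrightarrow> v \<in> fspace (B {}) \<Longrightarrow> \<epsilon> (m {} {} (u \<otimes>\<^sub>v v)) = \<epsilon> u * \<epsilon> v"
    and \<Delta>_one: "\<Delta> {} {} one = one \<otimes>\<^sub>v one"
    and \<epsilon>_one: "\<epsilon> one = 1"


section \<open>Indexed noncrossing partitions\<close>

definition noncrossing_partition :: "nat \<Rightarrow> nat set set \<Rightarrow> bool" where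
  "noncrossing_partition n P \<longleftrightarrow> n \<ge> 1 \<and> partition_on {1..n} P \<and>
     \<not> (\<exists>b\<in>P. \<exists>b'\<in>P. b \<noteq> b' \<and>
          (\<exists>x\<in>b. \<exists>z\<in>b. \<exists>y\<in>b'. \<exists>t\<in>b'. x < y \<and> y < z \<and> z < t))"

text \<open>
  An indexed noncrossing partition is the family of its blocks, extended by the empty set outside
  the index set. Blocks being nonempty, the index set can be read off from the family, and \<open>n\<close> is
  determined by the union of the blocks.
\<close>

type_synonym 'x block_family = "'x \<Rightarrow> nat set"

definition indexed_ncp :: "'x set \<Rightarrow> 'x block_family set" where
  "indexed_ncp X = {\<pi>. (\<exists>n. noncrossing_partition n (\<pi> ` X)) \<and> inj_on \<pi> X \<and> (\<forall>x. x \<notin> X \<longrightarrow> \<pi> x = {})}"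

definition index_set :: "'x block_family \<Rightarrow> 'x set" where
  "index_set \<pi> = {x. \<pi> x \<noteq> {}}"

text \<open>If \<open>\<sigma>\<close> is injective on the index set, the union below has at most one nonempty term.\<close>

definition relabel :: "('x \<Rightarrow> 'x) \<Rightarrow> 'x block_family \<Rightarrow> 'x block_family" where
  "relabel \<sigma> \<pi> = (\<lambda>y. \<Union>x\<in>{x. \<sigma> x = y}. \<pi> x)"

text \<open>The map \<open>p \<mapsto> card {q \<in> S. q \<le> p}\<close> is the increasing bijection from \<open>S\<close> onto \<open>{1..card S}\<close>.\<close>

definition ncp_restrict :: "'x block_family \<Rightarrow> 'x set \<Rightarrow> 'x block_family" where
  "ncp_restrict \<pi> Y = (let S = (\<Union>y\<in>Y. \<pi> y) in
     (\<lambda>x. if x \<in> Y then (\<lambda>p. card {q \<in> S. q \<le> p}) ` \<pi> x else {}))"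

definition is_interval :: "nat set \<Rightarrow> bool" where
  "is_interval C \<longleftrightarrow> (\<exists>a b. a \<le> b \<and> C = {a..b})"

definition conn_components :: "nat set \<Rightarrow> nat set set" where
  "conn_components S = {C. is_interval C \<and> C \<subseteq> S \<and>
     (\<forall>D. is_interval D \<and> C \<subseteq> D \<and> D \<subseteq> S \<longrightarrow> D = C)}"

definition is_ideal :: "'x block_family \<Rightarrow> 'x set \<Rightarrow> bool" where
  "is_ideal \<pi> I \<longleftrightarrow> I \<subseteq> index_set \<pi> \<and>
     (\<forall>C\<in>conn_components (\<Union>x\<in>I. \<pi> x). \<exists>Q\<subseteq>\<pi> ` index_set \<pi>. C = \<Union>Q)"


section \<open>The species \<open>A = Com \<circ> NCP\<close>\<close>

text \<open>
  A commutative monomial is the multiset of its factors; the product of monomials is the sum of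
  multisets and the empty monomial is \<open>0\<close>. In particular the type of finitely supported functions
  on monomials is the commutative monoid algebra of the monoid of monomials, and similarly the
  multiplication of finitely supported functions on pairs of monomials is given by
  \<open>(a \<otimes> b) * (a' \<otimes> b') = (a * a') \<otimes> (b * b')\<close>.
\<close>

type_synonym 'x monomial = "'x block_family multiset"

definition A_basis :: "'x set \<Rightarrow> 'x monomial set" where
  "A_basis X = {M. (\<forall>\<pi>\<in>#M. \<pi> \<in> indexed_ncp (index_set \<pi>)) \<and>
     (\<exists>P. finite P \<and> partition_on X P \<and> image_mset index_set M = mset_set P)}"

definition A_act ::
  "'x set \<Rightarrow> ('x \<Rightarrow> 'x) \<Rightarrow> ('x monomial \<Rightarrow>\<^sub>0 'k::field) \<Rightarrow> ('x monomial \<Rightarrow>\<^sub>0 'k)" where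
  "A_act X \<sigma> = lin_ext (\<lambda>M. basis_vec (image_mset (relabel \<sigma>) M))"

definition A_mult ::
  "'x set \<Rightarrow> 'x set \<Rightarrow> ('x monomial \<times> 'x monomial \<Rightarrow>\<^sub>0 'k::field) \<Rightarrow> ('x monomial \<Rightarrow>\<^sub>0 'k)" where
  "A_mult X Y = lin_ext (\<lambda>(M, N). basis_vec (M + N))"

definition A_one :: "'x monomial \<Rightarrow>\<^sub>0 'k::field" where
  "A_one = basis_vec {#}"

text \<open>The monomials \<open>\<pi>\<^bsub>|Y\<^esub>\<close> and, for an ideal \<open>I\<close>, \<open>\<pi>\<^bsub>|\<cdot>I\<^esub>\<close>.\<close>

definition restrict_mon :: "'x block_family \<Rightarrow> 'x set \<Rightarrow> 'x monomial" where
  "restrict_mon \<pi> Y = (if Y = {} then {#} else {#ncp_restrict \<pi> Y#})"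

definition ideal_restrict_mon :: "'x block_family \<Rightarrow> 'x set \<Rightarrow> 'x monomial" where
  "ideal_restrict_mon \<pi> I =
     (\<Sum>C\<in>conn_components (\<Union>x\<in>I. \<pi> x). restrict_mon \<pi> {x\<in>I. \<pi> x \<subseteq> C})"

definition ncp_coprod ::
  "'x set \<Rightarrow> 'x set \<Rightarrow> 'x block_family \<Rightarrow> ('x monomial \<times> 'x monomial \<Rightarrow>\<^sub>0 'k::field)" where
  "ncp_coprod I J \<pi> =
     (if is_ideal \<pi> J then basis_vec (restrict_mon \<pi> I) \<otimes>\<^sub>v basis_vec (ideal_restrict_mon \<pi> J) else 0)"

definition A_coprod ::
  "'x set \<Rightarrow> 'x set \<Rightarrow> ('x monomial \<Rightarrow>\<^sub>0 'k::field) \<Rightarrow> ('x monomial \<times> 'x monomial \<Rightarrow>\<^sub>0 'k)" where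
  "A_coprod I J =
     lin_ext (\<lambda>M. \<Prod>\<pi>\<in>#M. ncp_coprod (I \<inter> index_set \<pi>) (J \<inter> index_set \<pi>) \<pi>)"

end

theory Submission
  imports Defs
begin

text \<open>
  All structure maps send a basis vector to a basis vector or to \<open>0\<close>, so each axiom is an identity
  between basis monomials (\<open>linear_eq_on_fspace\<close>). As the coproduct is multiplicative by construction,
  its compatibility with the product is formal, and coassociativity reduces to a single noncrossing
  partition \<open>\<pi>\<close>.

  The connected components in the definition of the coproduct are best replaced by a betweenness
  relation. Given a set \<open>A\<close> of blocks, two blocks are \<^emph>\<open>linked\<close> if no element of a block of \<open>A\<close> lies
  between an element of the first one and an element of the second one. Take for \<open>A\<close> the blocks outside \<open>J\<close>.
  Two elements of blocks of \<open>J\<close> are in the same connected component if and only if no element of a block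
  of \<open>A\<close> lies between them; hence \<open>J\<close> is an ideal if and only if every block of \<open>J\<close> is linked to itself
  (\<open>is_ideal_iff_linked\<close>), and in this case the factors of \<open>\<pi>\<^bsub>|\<cdot>J\<^esub>\<close> are the restrictions of \<open>\<pi>\<close> to
  the classes of mutually linked blocks of \<open>J\<close> (\<open>ideal_restrict_mon_linked_classes\<close>). Being linked only
  depends on the relative order of the elements of the blocks involved, hence it is not affected by
  passing to a restriction that contains these blocks (\<open>linked_ncp_restrict\<close>). This makes iterated
  coproducts computable in \<open>\<pi>\<close> itself.

  Let now the index set of \<open>\<pi>\<close> be the disjoint union of \<open>I\<close>, \<open>J\<close> and \<open>K\<close>. Both iterated coproducts are
  nonzero exactly if the blocks of \<open>J\<close> are self-linked with respect to \<open>I\<close> and those of \<open>K\<close> with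
  respect to \<open>I \<union> J\<close>, and then both have the three components \<open>\<pi>\<^bsub>|I\<^esub>\<close>, the product of the restrictions
  to the classes of \<open>J\<close> with respect to \<open>I\<close>, and that for the classes of \<open>K\<close> with respect to \<open>I \<union> J\<close>
  (\<open>coassoc_ideal\<close>, \<open>coassoc_restrict\<close>). On the side where \<open>J \<union> K\<close> is split off first, the blocks of
  \<open>K\<close> are only compared with the blocks of \<open>J\<close> in the same class of \<open>J \<union> K\<close>. This suffices, because a
  block of \<open>J\<close> with an element between two blocks of a class belongs to this class itself
  (\<open>linked_between\<close>, \<open>linked_within_class\<close>).
\<close>

section \<open>Linear maps determined by a basis\<close>

lemma lin_ext_zero [simp]: "lin_ext f 0 = 0"
  by (simp add: lin_ext_def)

lemma lin_ext_cong:
  assumes "v \<in> fspace A" "\<And>a. a \<in> A \<Longrightarrow> f a = g a"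
  shows "lin_ext f v = lin_ext g v"
  unfolding lin_ext_def using assms by (intro sum.cong) (auto simp: fspace_def)

lemma tensor_zero [simp]: "0 \<otimes>\<^sub>v v = 0" "u \<otimes>\<^sub>v 0 = 0"
  by (simp_all add: tensor_def)

lemma tensor_map_basis [simp]:
  "tensor_map f g (basis_vec (a, b)) = f (basis_vec a) \<otimes>\<^sub>v g (basis_vec b)"
  by (simp add: tensor_map_def)

lemma tensor_assoc_basis [simp]: "tensor_assoc (basis_vec ((a, b), c)) = basis_vec (a, b, c)"
  by (simp add: tensor_assoc_def)

lemma tensor_middle_flip_basis [simp]:
  "tensor_middle_flip (basis_vec ((a, b), (c, d))) = basis_vec ((a, c), (b, d))"
  by (simp add: tensor_middle_flip_def)

lemma tensor_maps_zero [simp]: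
  "tensor_map f g 0 = 0" "tensor_assoc 0 = 0" "tensor_middle_flip 0 = 0"
  by (simp_all add: tensor_map_def tensor_assoc_def tensor_middle_flip_def)

lemma linear_lin_ext: "linear_on UNIV UNIV (lin_ext f)"
  by (rule linear_on_lin_ext) (simp add: fspace_def)

lemma linear_compose:
  assumes "linear_on UNIV UNIV f" "linear_on UNIV UNIV g"
  shows "linear_on UNIV UNIV (\<lambda>v. f (g v))"
  using assms unfolding linear_on_def fspace_def by simp

lemma linear_ident: "linear_on UNIV UNIV (\<lambda>v. v)"
  by (simp add: linear_on_def fspace_def)

text \<open>
  Every map in the axioms is given by \<open>lin_ext\<close> or composed of such maps, so it is additive and
  homogeneous on all finitely supported functions. Linearity on \<open>UNIV\<close> is stable under composition
  without keeping track of the bases; only the final comparison needs the basis \<open>A\<close>.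
\<close>

lemma linear_eq_on_fspace:
  assumes "v \<in> fspace A" "linear_on UNIV UNIV f" "linear_on UNIV UNIV g"
    and "\<And>a. a \<in> A \<Longrightarrow> f (basis_vec a) = g (basis_vec a)"
  shows "f v = g v"
proof -
  have "f v = lin_ext (\<lambda>a. f (basis_vec a)) v" "g v = lin_ext (\<lambda>a. g (basis_vec a)) v"
    by (intro linear_on_expansion[OF assms(2)] linear_on_expansion[OF assms(3)]; simp add: fspace_def)+
  then show ?thesis using lin_ext_cong[OF assms(1,4)] by simp
qed

lemma tensor_left_linear: "linear_on UNIV UNIV (\<lambda>v. basis_vec a \<otimes>\<^sub>v v)"
  and tensor_right_linear: "linear_on UNIV UNIV (\<lambda>v. v \<otimes>\<^sub>v basis_vec b)"
  unfolding linear_on_def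
  by (auto simp: fspace_def lookup_add algebra_simps intro!: poly_mapping_eqI)

section \<open>Order-preserving renumbering\<close>

text \<open>
  The renumbering in \<open>ncp_restrict\<close>. Composing two restrictions rests on \<open>rank_rank\<close>: renumbering
  by \<open>S\<close> and then by the image of \<open>T \<subseteq> S\<close> is renumbering by \<open>T\<close>.
\<close>

definition rank :: "nat set \<Rightarrow> nat \<Rightarrow> nat" where
  "rank S p = card {q \<in> S. q \<le> p}"

lemma rank_mono: "finite S \<Longrightarrow> p \<le> q \<Longrightarrow> rank S p \<le> rank S q"
  unfolding rank_def by (rule card_mono) auto

lemma rank_less: "finite S \<Longrightarrow> q \<in> S \<Longrightarrow> p < q \<Longrightarrow> rank S p < rank S q"
  unfolding rank_def by (rule psubset_card_mono) (auto simp: psubset_eq set_eq_iff intro!: exI[of _ q])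

lemma rank_less_iff: "finite S \<Longrightarrow> p \<in> S \<Longrightarrow> q \<in> S \<Longrightarrow> rank S p < rank S q \<longleftrightarrow> p < q"
  by (meson linorder_not_le rank_less rank_mono)

lemma rank_le_iff: "finite S \<Longrightarrow> p \<in> S \<Longrightarrow> q \<in> S \<Longrightarrow> rank S p \<le> rank S q \<longleftrightarrow> p \<le> q"
  by (meson linorder_not_le rank_less_iff)

lemma inj_on_rank: "finite S \<Longrightarrow> inj_on (rank S) S"
  by (rule inj_onI) (metis order.eq_iff rank_le_iff)

lemma rank_image:
  assumes "finite S"
  shows "rank S ` S = {1..card S}"
proof (rule card_subset_eq)
  show "rank S ` S \<subseteq> {1..card S}"
  proof
    fix k assume "k \<in> rank S ` S"
    then obtain p where p: "p \<in> S" "k = rank S p" by blast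
    have "card {p} \<le> rank S p"
      unfolding rank_def using p assms by (intro card_mono) auto
    moreover have "rank S p \<le> card S"
      unfolding rank_def using assms by (intro card_mono) auto
    ultimately show "k \<in> {1..card S}" using p by auto
  qed
qed (simp_all add: card_image inj_on_rank assms)

lemma rank_rank:
  assumes "finite S" "T \<subseteq> S" "p \<in> S"
  shows "rank (rank S ` T) (rank S p) = rank T p"
proof -
  have "{q \<in> rank S ` T. q \<le> rank S p} = rank S ` {q \<in> T. q \<le> p}"
    using assms by (auto simp: rank_le_iff subset_iff)
  moreover have "inj_on (rank S) {q \<in> T. q \<le> p}"
    using inj_on_rank[OF assms(1)] by (rule inj_on_subset) (use assms in auto)
  ultimately show ?thesis
    unfolding rank_def[of "rank S ` T"] rank_def[of T] by (simp add: card_image)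
qed

lemma rank_initial_segment: "p \<in> {1..n} \<Longrightarrow> rank {1..n} p = p"
proof -
  assume "p \<in> {1..n}"
  then have "{q \<in> {1..n}. q \<le> p} = {1..p}" by auto
  then show ?thesis by (simp add: rank_def)
qed

section \<open>Indexed noncrossing partitions and their restrictions\<close>

text \<open>
  The conditions on the set of blocks, restated on the family: injectivity of the indexing is absorbed
  by requiring blocks with distinct indices to be disjoint. In this form the conditions can be checked
  one index at a time.
\<close>

lemma indexed_ncp_iff:
  "\<pi> \<in> indexed_ncp X \<longleftrightarrow>
     X \<noteq> {} \<and> (\<forall>x. \<pi> x \<noteq> {} \<longleftrightarrow> x \<in> X) \<and> (\<forall>x y. x \<noteq> y \<longrightarrow> \<pi> x \<inter> \<pi> y = {}) \<and>
     (\<exists>n. (\<Union>x\<in>X. \<pi> x) = {1..n}) \<and>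
     (\<forall>x y p q r s. x \<noteq> y \<longrightarrow> p \<in> \<pi> x \<longrightarrow> r \<in> \<pi> x \<longrightarrow> q \<in> \<pi> y \<longrightarrow> s \<in> \<pi> y \<longrightarrow>
        \<not> (p < q \<and> q < r \<and> r < s))" (is "?L \<longleftrightarrow> ?R")
proof
  assume ?L
  then obtain n where n: "n \<ge> 1" "partition_on {1..n} (\<pi> ` X)"
    and nc0: "\<not> (\<exists>b\<in>\<pi> ` X. \<exists>b'\<in>\<pi> ` X. b \<noteq> b' \<and>
          (\<exists>x\<in>b. \<exists>z\<in>b. \<exists>y\<in>b'. \<exists>t\<in>b'. x < y \<and> y < z \<and> z < t))"
    and inj: "inj_on \<pi> X" and out: "\<forall>x. x \<notin> X \<longrightarrow> \<pi> x = {}"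
    unfolding indexed_ncp_def noncrossing_partition_def by blast
  have nc: "\<forall>x\<in>X. \<forall>y\<in>X. \<pi> x \<noteq> \<pi> y \<longrightarrow>
      (\<forall>p\<in>\<pi> x. \<forall>r\<in>\<pi> x. \<forall>q\<in>\<pi> y. \<forall>s\<in>\<pi> y. \<not> (p < q \<and> q < r \<and> r < s))"
    using nc0 by (simp only: ball_simps bex_simps not_ex) blast
  have u: "\<Union>(\<pi> ` X) = {1..n}" and d: "disjoint (\<pi> ` X)" and ne: "{} \<notin> \<pi> ` X"
    using n(2) by (auto simp: partition_on_def)
  have ne': "\<pi> x \<noteq> {} \<longleftrightarrow> x \<in> X" for x using out ne by fastforce
  have dis: "\<pi> x \<inter> \<pi> y = {}" if "x \<noteq> y" for x y
  proof (cases "x \<in> X \<and> y \<in> X")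
    case True
    then have "\<pi> x \<noteq> \<pi> y" using inj that by (auto dest: inj_onD)
    then show ?thesis using d True by (auto simp: disjoint_def)
  qed (use out in auto)
  have X: "X \<noteq> {}" using u n(1) by auto
  have nc': "\<not> (p < q \<and> q < r \<and> r < s)"
    if "x \<noteq> y" "p \<in> \<pi> x" "r \<in> \<pi> x" "q \<in> \<pi> y" "s \<in> \<pi> y" for x y p q r s
  proof
    assume "p < q \<and> q < r \<and> r < s"
    moreover have "x \<in> X" "y \<in> X" using that ne' by blast+
    moreover have "\<pi> x \<noteq> \<pi> y" using dis[OF that(1)] that by auto
    ultimately show False using nc that by blast
  qed
  show ?R
    by (intro conjI allI impI exI[of _ n] X ne' u dis) (assumption | rule nc', assumption+)+
next
  assume R: ?R
  then obtain n where X: "X \<noteq> {}" and ne: "\<forall>x. \<pi> x \<noteq> {} \<longleftrightarrow> x \<in> X"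
    and dis: "\<forall>x y. x \<noteq> y \<longrightarrow> \<pi> x \<inter> \<pi> y = {}" and u: "(\<Union>x\<in>X. \<pi> x) = {1..n}"
    and nc: "\<forall>x y p q r s. x \<noteq> y \<longrightarrow> p \<in> \<pi> x \<longrightarrow> r \<in> \<pi> x \<longrightarrow> q \<in> \<pi> y \<longrightarrow> s \<in> \<pi> y \<longrightarrow>
        \<not> (p < q \<and> q < r \<and> r < s)"
    by (elim conjE exE) (rule that)
  obtain x where "x \<in> X" using X by blast
  then obtain p where "p \<in> \<pi> x" using ne by blast
  then have "p \<in> {1..n}" using u \<open>x \<in> X\<close> by blast
  then have n: "n \<ge> 1" by simp
  have part: "partition_on {1..n} (\<pi> ` X)"
  proof (rule partition_onI)
    fix a b assume "a \<in> \<pi> ` X" "b \<in> \<pi> ` X" "a \<noteq> b"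
    then obtain x y where "a = \<pi> x" "b = \<pi> y" "x \<noteq> y" by blast
    then show "disjnt a b" using dis by (simp add: disjnt_def)
  qed (use u ne in auto)
  have inj: "inj_on \<pi> X"
    by (rule inj_onI) (metis dis inf.idem ne)
  have "\<not> (\<exists>b\<in>\<pi> ` X. \<exists>b'\<in>\<pi> ` X. b \<noteq> b' \<and>
      (\<exists>x\<in>b. \<exists>z\<in>b. \<exists>y\<in>b'. \<exists>t\<in>b'. x < y \<and> y < z \<and> z < t))"
  proof (rule notI, elim bexE conjE imageE, hypsubst)
    fix x y p r q s
    assume "\<pi> x \<noteq> \<pi> y" "p \<in> \<pi> x" "r \<in> \<pi> x" "q \<in> \<pi> y" "s \<in> \<pi> y" "p < q" "q < r" "r < s"
    then show False using nc[rule_format, of x y p r q s] by blast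
  qed
  then show ?L
    unfolding indexed_ncp_def noncrossing_partition_def 
    using n part inj ne by (intro CollectI conjI allI impI exI[of _ n]) blast+
qed

lemma indexed_ncp_block_nonempty: "\<pi> \<in> indexed_ncp X \<Longrightarrow> \<pi> x \<noteq> {} \<longleftrightarrow> x \<in> X"
  by (simp add: indexed_ncp_iff)

lemma indexed_ncp_block_disjoint: "\<pi> \<in> indexed_ncp X \<Longrightarrow> p \<in> \<pi> x \<Longrightarrow> p \<in> \<pi> y \<Longrightarrow> x = y"
  by (auto simp: indexed_ncp_iff)

lemma indexed_ncp_Union: "\<pi> \<in> indexed_ncp X \<Longrightarrow> \<exists>n. (\<Union>x\<in>X. \<pi> x) = {1..n}"
  by (simp add: indexed_ncp_iff)

lemma indexed_ncp_index_set: "\<pi> \<in> indexed_ncp X \<Longrightarrow> index_set \<pi> = X"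
  by (auto simp: indexed_ncp_iff index_set_def)

lemma indexed_ncp_finite:
  assumes "\<pi> \<in> indexed_ncp X"
  shows "finite X"
proof -
  obtain n where "partition_on {1..n} (\<pi> ` X)" "inj_on \<pi> X"
    using assms unfolding indexed_ncp_def noncrossing_partition_def by blast
  then show ?thesis
    using finite_elements finite_imageD by blast
qed

lemma indexed_ncp_finite_Union:
  assumes "\<pi> \<in> indexed_ncp X" "Y \<subseteq> X"
  shows "finite (\<Union>x\<in>Y. \<pi> x)"
proof -
  obtain n where "(\<Union>x\<in>X. \<pi> x) = {1..n}" using indexed_ncp_Union[OF assms(1)] by blast
  then show ?thesis using assms(2)
    by (metis finite_atLeastAtMost finite_subset SUP_subset_mono subset_refl)
qed

lemma ncp_restrict_rank:
  "ncp_restrict \<pi> Y x = (if x \<in> Y then rank (\<Union>y\<in>Y. \<pi> y) ` \<pi> x else {})"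
  by (simp add: ncp_restrict_def rank_def Let_def)

text \<open>
  The renumbering is injective, increasing and onto an initial segment, hence it preserves
  disjointness and reflects crossings.
\<close>

lemma ncp_restrict_in_indexed_ncp:
  assumes \<pi>: "\<pi> \<in> indexed_ncp X" and Y: "Y \<subseteq> X" "Y \<noteq> {}"
  shows "ncp_restrict \<pi> Y \<in> indexed_ncp Y"
proof -
  let ?S = "\<Union>y\<in>Y. \<pi> y"
  have fin: "finite ?S" using indexed_ncp_finite_Union[OF \<pi> Y(1)] .
  note inj = inj_on_rank[OF fin]
  have "(\<Union>x\<in>Y. ncp_restrict \<pi> Y x) = rank ?S ` ?S"
    by (auto simp: ncp_restrict_rank)
  also have "\<dots> = {1..card ?S}" by (rule rank_image[OF fin])
  finally have u: "\<exists>n. (\<Union>x\<in>Y. ncp_restrict \<pi> Y x) = {1..n}" by blast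
  have ne: "\<forall>x. ncp_restrict \<pi> Y x \<noteq> {} \<longleftrightarrow> x \<in> Y"
    using indexed_ncp_block_nonempty[OF \<pi>] Y by (auto simp: ncp_restrict_rank)
  have dis: "ncp_restrict \<pi> Y x \<inter> ncp_restrict \<pi> Y y = {}" if "x \<noteq> y" for x y
  proof -
    have "\<pi> x \<inter> \<pi> y = {}" using that \<pi> by (simp add: indexed_ncp_iff)
    then show ?thesis
      using inj by (auto simp: ncp_restrict_rank dest!: inj_onD)
  qed
  have nc: "\<not> (p < q \<and> q < r \<and> r < s)"
    if "x \<noteq> y" "p \<in> ncp_restrict \<pi> Y x" "r \<in> ncp_restrict \<pi> Y x"
      "q \<in> ncp_restrict \<pi> Y y" "s \<in> ncp_restrict \<pi> Y y" for x y p q r s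
  proof
    assume a: "p < q \<and> q < r \<and> r < s"
    have xy: "x \<in> Y" "y \<in> Y" using that by (auto simp: ncp_restrict_rank split: if_splits)
    then have "p \<in> rank ?S ` \<pi> x" "r \<in> rank ?S ` \<pi> x" "q \<in> rank ?S ` \<pi> y" "s \<in> rank ?S ` \<pi> y"
      using that by (simp_all add: ncp_restrict_rank)
    then obtain p' q' r' s' where e: "p' \<in> \<pi> x" "r' \<in> \<pi> x" "q' \<in> \<pi> y" "s' \<in> \<pi> y"
      "p = rank ?S p'" "q = rank ?S q'" "r = rank ?S r'" "s = rank ?S s'"
      by (elim imageE) (rule that)
    then have "p' \<in> ?S" "q' \<in> ?S" "r' \<in> ?S" "s' \<in> ?S" using xy by blast+
    then have "p' < q'" "q' < r'" "r' < s'" using a e rank_less_iff[OF fin] by auto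
    moreover have "\<not> (p' < q' \<and> q' < r' \<and> r' < s')"
      using \<pi> that(1) e(1-4) by (simp add: indexed_ncp_iff)
    ultimately show False by blast
  qed
  show ?thesis
    unfolding indexed_ncp_iff
    by (intro conjI allI impI Y(2) ne[rule_format] u dis) (assumption | rule nc, assumption+)+
qed

lemma ncp_restrict_ncp_restrict:
  assumes \<pi>: "\<pi> \<in> indexed_ncp X" and YZ: "Z \<subseteq> Y" "Y \<subseteq> X"
  shows "ncp_restrict (ncp_restrict \<pi> Y) Z = ncp_restrict \<pi> Z"
proof
  fix x
  let ?S = "\<Union>y\<in>Y. \<pi> y" and ?T = "\<Union>y\<in>Z. \<pi> y"
  have fin: "finite ?S" using indexed_ncp_finite_Union[OF \<pi> YZ(2)] .
  have T: "(\<Union>y\<in>Z. ncp_restrict \<pi> Y y) = rank ?S ` ?T"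
    using YZ(1) by (auto simp: ncp_restrict_rank)
  have "rank (rank ?S ` ?T) (rank ?S p) = rank ?T p" if "x \<in> Z" "p \<in> \<pi> x" for p
    using that YZ(1) by (intro rank_rank[OF fin]) blast+
  then show "ncp_restrict (ncp_restrict \<pi> Y) Z x = ncp_restrict \<pi> Z x"
    unfolding ncp_restrict_rank[of "ncp_restrict \<pi> Y"] T
    using YZ(1) by (auto simp: ncp_restrict_rank image_image cong: image_cong_simp)
qed

lemma ncp_restrict_self:
  assumes \<pi>: "\<pi> \<in> indexed_ncp X"
  shows "ncp_restrict \<pi> X = \<pi>"
proof
  fix x
  obtain n where n: "(\<Union>x\<in>X. \<pi> x) = {1..n}" using indexed_ncp_Union[OF \<pi>] by blast
  have "rank {1..n} ` \<pi> x = (\<lambda>p. p) ` \<pi> x" if "x \<in> X"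
  proof (rule image_cong[OF refl])
    fix p assume "p \<in> \<pi> x"
    then have "p \<in> {1..n}" using that n by blast
    then show "rank {1..n} p = p" by (rule rank_initial_segment)
  qed
  then show "ncp_restrict \<pi> X x = \<pi> x"
    using indexed_ncp_block_nonempty[OF \<pi>] by (auto simp: ncp_restrict_rank n)
qed

section \<open>Connected components\<close>

text \<open>
  The elements \<open>q\<close> such that the whole segment between \<open>p\<close> and \<open>q\<close>, in whichever order they are, lies
  in \<open>S\<close>. Unlike the maximality in \<open>conn_components\<close>, this is a condition on pairs of elements.
\<close>

definition component :: "nat set \<Rightarrow> nat \<Rightarrow> nat set" where
  "component S p = {q. \<forall>r. p \<le> r \<and> r \<le> q \<or> q \<le> r \<and> r \<le> p \<longrightarrow> r \<in> S}"

lemma component_subset: "component S p \<subseteq> S"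
proof
  fix q assume "q \<in> component S p"
  moreover have "p \<le> q \<and> q \<le> q \<or> q \<le> q \<and> q \<le> p" by linarith
  ultimately show "q \<in> S" unfolding component_def by blast
qed

lemma component_self: "p \<in> S \<Longrightarrow> p \<in> component S p"
  unfolding component_def using order.antisym by blast

lemma component_sym: "q \<in> component S p \<Longrightarrow> p \<in> component S q"
  unfolding component_def by blast

lemma component_trans:
  assumes "q \<in> component S p" "r \<in> component S q"
  shows "r \<in> component S p"
  unfolding component_def
proof (intro CollectI allI impI)
  fix t assume "p \<le> t \<and> t \<le> r \<or> r \<le> t \<and> t \<le> p"
  then have "(p \<le> t \<and> t \<le> q \<or> q \<le> t \<and> t \<le> p) \<or> (q \<le> t \<and> t \<le> r \<or> r \<le> t \<and> t \<le> q)"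
    by linarith
  then show "t \<in> S" using assms unfolding component_def by blast
qed

lemma component_eq: "q \<in> component S p \<Longrightarrow> component S q = component S p"
  by (intro set_eqI iffI) (metis component_sym component_trans)+

lemma is_interval_component:
  assumes "finite S" "p \<in> S"
  shows "is_interval (component S p)"
proof -
  let ?C = "component S p"
  have fin: "finite ?C" and ne: "p \<in> ?C"
    using finite_subset[OF component_subset assms(1)] component_self[OF assms(2)] by simp_all
  have m: "Min ?C \<in> ?C" "Max ?C \<in> ?C" using Min_in[OF fin] Max_in[OF fin] ne by auto
  have b: "Min ?C \<le> p" "p \<le> Max ?C" using fin ne by simp_all
  have "q \<in> ?C" if q: "Min ?C \<le> q" "q \<le> Max ?C" for q
    unfolding component_def
  proof (intro CollectI allI impI)
    fix r assume "p \<le> r \<and> r \<le> q \<or> q \<le> r \<and> r \<le> p"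
    then have "Min ?C \<le> r \<and> r \<le> p \<or> p \<le> r \<and> r \<le> Max ?C" using q by linarith
    then show "r \<in> S" using m unfolding component_def by blast
  qed
  then have "{Min ?C..Max ?C} \<subseteq> ?C" by (intro subsetI) (simp only: atLeastAtMost_iff)
  moreover have "?C \<subseteq> {Min ?C..Max ?C}" using fin by (intro subsetI) simp
  ultimately have "?C = {Min ?C..Max ?C}" by (rule equalityI[rotated])
  moreover have "Min ?C \<le> Max ?C" using b by linarith
  ultimately show ?thesis unfolding is_interval_def by blast
qed

lemma interval_subset_component:
  assumes "is_interval D" "D \<subseteq> S" "p \<in> D"
  shows "D \<subseteq> component S p"
proof
  fix q assume q: "q \<in> D"
  obtain a b where D: "D = {a..b}" using assms(1) unfolding is_interval_def by blast
  have "r \<in> D" if "p \<le> r \<and> r \<le> q \<or> q \<le> r \<and> r \<le> p" for r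
    using that q assms(3) unfolding D atLeastAtMost_iff by linarith
  then show "q \<in> component S p" using assms(2) unfolding component_def by blast
qed

lemma conn_components_eq:
  assumes "finite S"
  shows "conn_components S = component S ` S"
proof (intro set_eqI iffI)
  fix C assume "C \<in> conn_components S"
  then have C: "is_interval C" "C \<subseteq> S" "\<And>D. is_interval D \<Longrightarrow> C \<subseteq> D \<Longrightarrow> D \<subseteq> S \<Longrightarrow> D = C"
    by (auto simp: conn_components_def)
  then obtain a b where "a \<le> b" "C = {a..b}" unfolding is_interval_def by blast
  then obtain p where p: "p \<in> C" by auto
  have "component S p = C"
    using C p by (intro C(3) is_interval_component interval_subset_component component_subset assms) auto
  then show "C \<in> component S ` S" using p C(2) by blast
next
  fix C assume "C \<in> component S ` S"
  then obtain p where p: "p \<in> S" "C = component S p" by blast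
  have "D = C" if "is_interval D" "C \<subseteq> D" "D \<subseteq> S" for D
    using interval_subset_component[of D S p] component_self[of p S] that p by blast
  then show "C \<in> conn_components S"
    unfolding conn_components_def using p is_interval_component[OF assms] component_subset by blast
qed

section \<open>Linked blocks\<close>

text \<open>
  For \<open>x\<close> and \<open>y\<close> outside \<open>A\<close>, no element of a block in \<open>A\<close> separates the blocks \<open>\<pi> x\<close> and \<open>\<pi> y\<close>;
  the case \<open>x = y\<close> says that no such element lies between two elements of the block \<open>\<pi> x\<close>. The set \<open>A\<close> is
  the set of indices of the obstacles, not of the blocks that are compared.
\<close>

definition linked :: "'x block_family \<Rightarrow> 'x set \<Rightarrow> 'x \<Rightarrow> 'x \<Rightarrow> bool" where
  "linked \<pi> A x y \<longleftrightarrow>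
     (\<forall>z\<in>A. \<forall>r\<in>\<pi> z. \<forall>p\<in>\<pi> x. \<forall>q\<in>\<pi> y. \<not> (p \<le> r \<and> r \<le> q) \<and> \<not> (q \<le> r \<and> r \<le> p))"

definition linked_classes :: "'x block_family \<Rightarrow> 'x set \<Rightarrow> 'x set \<Rightarrow> 'x set set" where
  "linked_classes \<pi> A J = (\<lambda>x. {y \<in> J. linked \<pi> A x y}) ` J"

lemma linked_sym: "linked \<pi> A x y \<Longrightarrow> linked \<pi> A y x"
  by (auto simp: linked_def)

lemma linked_antimono: "linked \<pi> A x y \<Longrightarrow> B \<subseteq> A \<Longrightarrow> linked \<pi> B x y"
  unfolding linked_def by blast

text \<open>
  Whatever lies between \<open>p\<close> and \<open>q\<close> lies between \<open>p\<close> and \<open>s\<close> or between \<open>s\<close> and \<open>q\<close>, for any \<open>s\<close>; an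
  element \<open>s\<close> of the middle block is what this needs.
\<close>

lemma linked_trans:
  assumes "linked \<pi> A x y" "linked \<pi> A y z" "\<pi> y \<noteq> {}"
  shows "linked \<pi> A x z"
proof -
  obtain s where s: "s \<in> \<pi> y" using assms(3) by blast
  show ?thesis
    unfolding linked_def
  proof (intro ballI)
    fix w r p q assume a: "w \<in> A" "r \<in> \<pi> w" "p \<in> \<pi> x" "q \<in> \<pi> z"
    have "\<not> (p \<le> r \<and> r \<le> s) \<and> \<not> (s \<le> r \<and> r \<le> p)" "\<not> (s \<le> r \<and> r \<le> q) \<and> \<not> (q \<le> r \<and> r \<le> s)"
      using assms(1,2) a s unfolding linked_def by blast+
    then show "\<not> (p \<le> r \<and> r \<le> q) \<and> \<not> (q \<le> r \<and> r \<le> p)" by linarith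
  qed
qed

text \<open>
  A block that reaches between two linked blocks is linked to them: an obstacle between \<open>p'\<close> and
  \<open>r'\<close> would lie between \<open>p'\<close> and \<open>p\<close>, between \<open>p\<close> and \<open>r\<close> (hence between \<open>p\<close> and \<open>q\<close>), or between
  \<open>r\<close> and \<open>r'\<close>. These are excluded by \<open>xx\<close>, \<open>xy\<close> and \<open>zz\<close>.
\<close>

lemma linked_between:
  assumes xy: "linked \<pi> A x y" and zz: "linked \<pi> A z z"
    and xx: "linked \<pi> A x x"
    and r: "r \<in> \<pi> z" "p \<in> \<pi> x" "q \<in> \<pi> y" "p \<le> r \<and> r \<le> q \<or> q \<le> r \<and> r \<le> p"
  shows "linked \<pi> A x z"
  unfolding linked_def
proof (intro ballI)
  fix w s p' r' assume a: "w \<in> A" "s \<in> \<pi> w" "p' \<in> \<pi> x" "r' \<in> \<pi> z"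
  have "\<not> (p \<le> s \<and> s \<le> q) \<and> \<not> (q \<le> s \<and> s \<le> p)"
    using xy a r unfolding linked_def by blast
  moreover have "\<not> (r \<le> s \<and> s \<le> r') \<and> \<not> (r' \<le> s \<and> s \<le> r)"
    using zz a r unfolding linked_def by blast
  moreover have "\<not> (p \<le> s \<and> s \<le> p') \<and> \<not> (p' \<le> s \<and> s \<le> p)"
    using xx a r unfolding linked_def by blast
  ultimately show "\<not> (p' \<le> s \<and> s \<le> r') \<and> \<not> (r' \<le> s \<and> s \<le> p')" using r(4) by linarith
qed

text \<open>
  The definition only mentions the order between elements of blocks indexed by \<open>Y\<close>, and the
  renumbering preserves and reflects this order.
\<close>

lemma linked_ncp_restrict:
  assumes \<pi>: "\<pi> \<in> indexed_ncp X" and Y: "Y \<subseteq> X" "A \<subseteq> Y" "x \<in> Y" "y \<in> Y"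
  shows "linked (ncp_restrict \<pi> Y) A x y \<longleftrightarrow> linked \<pi> A x y"
proof -
  let ?S = "\<Union>y\<in>Y. \<pi> y"
  have fin: "finite ?S" using indexed_ncp_finite_Union[OF \<pi> Y(1)] .
  have le: "rank ?S p \<le> rank ?S q \<longleftrightarrow> p \<le> q" if "u \<in> Y" "v \<in> Y" "p \<in> \<pi> u" "q \<in> \<pi> v" for u v p q
    using that by (intro rank_le_iff[OF fin]) blast+
  have bl: "ncp_restrict \<pi> Y u = rank ?S ` \<pi> u" if "u \<in> Y" for u
    using that by (simp add: ncp_restrict_rank)
  have "linked (ncp_restrict \<pi> Y) A x y \<longleftrightarrow>
    (\<forall>z\<in>A. \<forall>r\<in>\<pi> z. \<forall>p\<in>\<pi> x. \<forall>q\<in>\<pi> y. \<not> (rank ?S p \<le> rank ?S r \<and> rank ?S r \<le> rank ?S q) \<and>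
      \<not> (rank ?S q \<le> rank ?S r \<and> rank ?S r \<le> rank ?S p))"
    unfolding linked_def bl[OF Y(3)] bl[OF Y(4)]
    using bl Y(2) by (simp add: subset_iff)
  also have "\<dots> \<longleftrightarrow> linked \<pi> A x y"
    unfolding linked_def
  proof (intro ball_cong refl)
    fix z r p q assume *: "z \<in> A" "r \<in> \<pi> z" "p \<in> \<pi> x" "q \<in> \<pi> y"
    have z: "z \<in> Y" using *(1) Y(2) by blast
    show "(\<not> (rank ?S p \<le> rank ?S r \<and> rank ?S r \<le> rank ?S q) \<and>
      \<not> (rank ?S q \<le> rank ?S r \<and> rank ?S r \<le> rank ?S p)) =
      (\<not> (p \<le> r \<and> r \<le> q) \<and> \<not> (q \<le> r \<and> r \<le> p))"
      by (simp only: le[OF Y(3) z *(3,2)] le[OF z Y(3) *(2,3)] le[OF z Y(4) *(2,4)] le[OF Y(4) z *(4,2)])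
  qed
  finally show ?thesis .
qed

lemma linked_classes_ncp_restrict:
  assumes \<pi>: "\<pi> \<in> indexed_ncp X" and Y: "Y \<subseteq> X" "A \<subseteq> Y" "J \<subseteq> Y"
  shows "linked_classes (ncp_restrict \<pi> Y) A J = linked_classes \<pi> A J"
  unfolding linked_classes_def
  using linked_ncp_restrict[OF \<pi> Y(1,2)] Y(3) by (intro image_cong refl Collect_cong) blast

lemma linked_classes_partition_on:
  assumes \<pi>: "\<pi> \<in> indexed_ncp X" and J: "J \<subseteq> X" "\<And>x. x \<in> J \<Longrightarrow> linked \<pi> A x x"
  shows "partition_on J (linked_classes \<pi> A J)"
proof -
  have ne: "\<pi> x \<noteq> {}" if "x \<in> J" for x
    using that J(1) indexed_ncp_block_nonempty[OF \<pi>] by blast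
  have eq: "{z \<in> J. linked \<pi> A x z} = {z \<in> J. linked \<pi> A y z}"
    if "x \<in> J" "y \<in> J" "w \<in> J" "linked \<pi> A x w" "linked \<pi> A y w" for x y w
  proof -
    have "linked \<pi> A x y" using linked_trans[OF that(4) linked_sym[OF that(5)] ne[OF that(3)]] .
    then have "linked \<pi> A x z \<longleftrightarrow> linked \<pi> A y z" for z
      using linked_trans ne[OF that(1)] ne[OF that(2)] linked_sym by metis
    then show ?thesis by simp
  qed
  show ?thesis
    unfolding partition_on_def disjoint_def
  proof (intro conjI ballI impI)
    show "\<Union>(linked_classes \<pi> A J) = J" "{} \<notin> linked_classes \<pi> A J"
      using J(2) by (auto simp: linked_classes_def)
    fix a b assume ab: "a \<in> linked_classes \<pi> A J" "b \<in> linked_classes \<pi> A J" "a \<noteq> b"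
    then obtain x y where xy: "x \<in> J" "y \<in> J" "a = {z \<in> J. linked \<pi> A x z}" "b = {z \<in> J. linked \<pi> A y z}"
      unfolding linked_classes_def by (elim imageE) (rule that)
    show "a \<inter> b = {}"
    proof (rule ccontr)
      assume "a \<inter> b \<noteq> {}"
      then obtain w where "w \<in> a" "w \<in> b" by blast
      then show False using eq[of x y w] xy ab(3) by simp
    qed
  qed
qed

text \<open>
  The blocks of \<open>\<pi>\<close> cover an initial segment, so a segment between two elements leaves the union
  of the blocks of \<open>J\<close> exactly where it meets a block outside \<open>J\<close>.
\<close>

lemma linked_iff_component:
  assumes \<pi>: "\<pi> \<in> indexed_ncp X" and J: "J \<subseteq> X" "x \<in> J" "y \<in> J"
  shows "linked \<pi> (X - J) x y \<longleftrightarrow> (\<forall>p\<in>\<pi> x. \<forall>q\<in>\<pi> y. q \<in> component (\<Union>z\<in>J. \<pi> z) p)"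
proof -
  obtain n where n: "(\<Union>x\<in>X. \<pi> x) = {1..n}" using indexed_ncp_Union[OF \<pi>] by blast
  have mem: "r \<in> (\<Union>z\<in>J. \<pi> z) \<longleftrightarrow> \<not> (\<exists>z\<in>X - J. r \<in> \<pi> z)" if r: "r \<in> {1..n}" for r
  proof -
    obtain z where z: "z \<in> X" "r \<in> \<pi> z" using r unfolding n[symmetric] by blast
    have "r \<in> \<pi> w \<longleftrightarrow> w = z" for w
      using indexed_ncp_block_disjoint[OF \<pi> z(2), of w] z(2) by metis
    then show ?thesis using z J(1) by auto
  qed
  have "q \<in> component (\<Union>z\<in>J. \<pi> z) p \<longleftrightarrow>
      (\<forall>z\<in>X - J. \<forall>r\<in>\<pi> z. \<not> (p \<le> r \<and> r \<le> q) \<and> \<not> (q \<le> r \<and> r \<le> p))"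
    if pq: "p \<in> \<pi> x" "q \<in> \<pi> y" for p q
  proof -
    have "p \<in> {1..n}" "q \<in> {1..n}" unfolding n[symmetric] using pq J by blast+
    then have "r \<in> {1..n}" if "p \<le> r \<and> r \<le> q \<or> q \<le> r \<and> r \<le> p" for r
      using that unfolding atLeastAtMost_iff by linarith
    then have "(\<forall>r. p \<le> r \<and> r \<le> q \<or> q \<le> r \<and> r \<le> p \<longrightarrow> r \<in> (\<Union>z\<in>J. \<pi> z)) \<longleftrightarrow>
        (\<forall>r. p \<le> r \<and> r \<le> q \<or> q \<le> r \<and> r \<le> p \<longrightarrow> \<not> (\<exists>z\<in>X - J. r \<in> \<pi> z))"
      by (intro all_cong1 imp_cong refl mem)
    then show ?thesis unfolding component_def mem_Collect_eq by blast
  qed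
  then show ?thesis unfolding linked_def by blast
qed

text \<open>
  A block of an ideal is contained in the component of each of its elements, since this component is
  a union of blocks; conversely, if every block of \<open>J\<close> is contained in the component of each of its
  elements, a component is the union of the blocks that it meets.
\<close>

lemma is_ideal_iff_linked:
  assumes \<pi>: "\<pi> \<in> indexed_ncp X"
  shows "is_ideal \<pi> J \<longleftrightarrow> J \<subseteq> X \<and> (\<forall>x\<in>J. linked \<pi> (X - J) x x)"
proof (cases "J \<subseteq> X")
  case True
  let ?S = "\<Union>z\<in>J. \<pi> z"
  have cc: "conn_components ?S = component ?S ` ?S"
    using conn_components_eq indexed_ncp_finite_Union[OF \<pi> True] by blast
  have lk: "linked \<pi> (X - J) x x \<longleftrightarrow> (\<forall>p\<in>\<pi> x. \<pi> x \<subseteq> component ?S p)" if "x \<in> J" for x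
    using linked_iff_component[OF \<pi> True that that] by blast
  show ?thesis
  proof (intro iffI conjI ballI)
    fix x assume id: "is_ideal \<pi> J" and x: "x \<in> J"
    have "\<pi> x \<subseteq> component ?S p" if p: "p \<in> \<pi> x" for p
    proof -
      have "component ?S p \<in> conn_components ?S" unfolding cc using x p by blast
      then obtain Q where Q: "Q \<subseteq> \<pi> ` X" "component ?S p = \<Union>Q"
        using id unfolding is_ideal_def indexed_ncp_index_set[OF \<pi>] by blast
      have "p \<in> ?S" using x p by blast
      then have "p \<in> \<Union>Q" unfolding Q(2)[symmetric] by (rule component_self)
      then obtain z where z: "\<pi> z \<in> Q" "p \<in> \<pi> z" using Q(1) by blast
      then have "z = x" using indexed_ncp_block_disjoint[OF \<pi> p] by simp
      then show ?thesis unfolding Q(2) using z(1) by blast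
    qed
    then show "linked \<pi> (X - J) x x" using lk[OF x] by blast
  next
    assume "J \<subseteq> X \<and> (\<forall>x\<in>J. linked \<pi> (X - J) x x)"
    then have sub: "\<pi> x \<subseteq> component ?S p" if "x \<in> J" "p \<in> \<pi> x" for x p
      using lk that by blast
    show "is_ideal \<pi> J"
      unfolding is_ideal_def indexed_ncp_index_set[OF \<pi>]
    proof (intro conjI ballI True)
      fix C assume "C \<in> conn_components ?S"
      then obtain p where p: "p \<in> ?S" "C = component ?S p" unfolding cc by blast
      have "C \<subseteq> \<Union>(\<pi> ` {x \<in> J. \<pi> x \<subseteq> C})"
      proof
        fix r assume r: "r \<in> C"
        then obtain x where x: "x \<in> J" "r \<in> \<pi> x" using component_subset[of ?S p] unfolding p(2) by blast
        have "\<pi> x \<subseteq> component ?S r" using sub[OF x] .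
        also have "\<dots> = C" using component_eq r p(2) by simp
        finally show "r \<in> \<Union>(\<pi> ` {x \<in> J. \<pi> x \<subseteq> C})" using x by blast
      qed
      then have "C = \<Union>(\<pi> ` {x \<in> J. \<pi> x \<subseteq> C})" by blast
      then show "\<exists>Q\<subseteq>\<pi> ` X. C = \<Union>Q"
        using True by (intro exI[of _ "\<pi> ` {x \<in> J. \<pi> x \<subseteq> C}"]) blast
    qed
  qed (use True in simp_all)
qed (auto simp: is_ideal_def indexed_ncp_index_set[OF \<pi>])

lemma sum_singleton_mset: "finite A \<Longrightarrow> (\<Sum>a\<in>A. {#f a#}) = image_mset f (mset_set A)"
  by (induction A rule: finite_induct) auto

text \<open>
  For an ideal \<open>J\<close>, sending a component to the set of blocks that it contains is a bijection from the
  components onto the classes of linked blocks, with inverse the union.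
\<close>

lemma ideal_restrict_mon_linked_classes:
  assumes \<pi>: "\<pi> \<in> indexed_ncp X" and id: "is_ideal \<pi> J"
  shows "ideal_restrict_mon \<pi> J =
    image_mset (ncp_restrict \<pi>) (mset_set (linked_classes \<pi> (X - J) J))"
proof -
  let ?S = "\<Union>z\<in>J. \<pi> z" and ?K = "linked_classes \<pi> (X - J) J"
  define g where "g C = {x \<in> J. \<pi> x \<subseteq> C}" for C
  have J: "J \<subseteq> X" and lrefl: "\<And>x. x \<in> J \<Longrightarrow> linked \<pi> (X - J) x x"
    using id is_ideal_iff_linked[OF \<pi>] by blast+
  have finJ: "finite J" using J indexed_ncp_finite[OF \<pi>] finite_subset by blast
  have cc: "conn_components ?S = component ?S ` ?S"
    using conn_components_eq indexed_ncp_finite_Union[OF \<pi> J] by blast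
  have sub: "\<pi> x \<subseteq> component ?S p" if "x \<in> J" "p \<in> \<pi> x" for x p
    using linked_iff_component[OF \<pi> J that(1) that(1)] lrefl that by blast
  have g: "g (component ?S p) = {y \<in> J. linked \<pi> (X - J) x y}" if x: "x \<in> J" "p \<in> \<pi> x" for x p
  proof -
    have eq: "component ?S p' = component ?S p" if "p' \<in> \<pi> x" for p'
      using sub[OF x] that by (intro component_eq) blast
    have "linked \<pi> (X - J) x y \<longleftrightarrow> \<pi> y \<subseteq> component ?S p" if "y \<in> J" for y
    proof -
      have "linked \<pi> (X - J) x y \<longleftrightarrow> (\<forall>p'\<in>\<pi> x. \<pi> y \<subseteq> component ?S p')"
        using linked_iff_component[OF \<pi> J x(1) that] by blast
      also have "\<dots> \<longleftrightarrow> (\<forall>p'\<in>\<pi> x. \<pi> y \<subseteq> component ?S p)"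
        by (intro ball_cong refl) (subst eq, assumption, rule refl)
      finally show ?thesis using x(2) by blast
    qed
    then show ?thesis unfolding g_def by blast
  qed
  have "g ` component ?S ` ?S = ?K"
  proof -
    have "g ` component ?S ` ?S = (\<Union>x\<in>J. (\<lambda>p. g (component ?S p)) ` \<pi> x)"
      by (simp add: image_UN image_image)
    also have "\<dots> = (\<Union>x\<in>J. {{y \<in> J. linked \<pi> (X - J) x y}})"
    proof (rule SUP_cong[OF refl])
      fix x assume x: "x \<in> J"
      have "\<pi> x \<noteq> {}" using x J indexed_ncp_block_nonempty[OF \<pi>] by blast
      then show "(\<lambda>p. g (component ?S p)) ` \<pi> x = {{y \<in> J. linked \<pi> (X - J) x y}}"
        using g[OF x] by auto
    qed
    also have "\<dots> = ?K" by (auto simp: linked_classes_def)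
    finally show ?thesis .
  qed
  moreover have "inj_on g (component ?S ` ?S)"
  proof (rule inj_on_inverseI[of _ "\<lambda>Y. \<Union>y\<in>Y. \<pi> y"])
    fix C assume "C \<in> component ?S ` ?S"
    then obtain p where p: "C = component ?S p" by blast
    have "r \<in> (\<Union>y\<in>g C. \<pi> y)" if r: "r \<in> C" for r
    proof -
      obtain x where x: "x \<in> J" "r \<in> \<pi> x"
        using r component_subset[of ?S p] unfolding p by blast
      have "\<pi> x \<subseteq> C" using sub[OF x] component_eq[of r ?S p] r p by simp
      then show ?thesis using x by (auto simp: g_def)
    qed
    then show "(\<Union>y\<in>g C. \<pi> y) = C" by (auto simp: g_def)
  qed
  ultimately have "bij_betw g (component ?S ` ?S) ?K"
    by (simp add: bij_betw_def)
  then have "ideal_restrict_mon \<pi> J = (\<Sum>W\<in>?K. restrict_mon \<pi> W)"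
    unfolding ideal_restrict_mon_def cc g_def[symmetric] by (rule sum.reindex_bij_betw)
  also have "\<dots> = (\<Sum>W\<in>?K. {#ncp_restrict \<pi> W#})"
    using lrefl by (intro sum.cong) (auto simp: linked_classes_def restrict_mon_def)
  also have "\<dots> = image_mset (ncp_restrict \<pi>) (mset_set ?K)"
    using finJ by (intro sum_singleton_mset) (simp add: linked_classes_def)
  finally show ?thesis .
qed

section \<open>Coproducts of monomials\<close>

text \<open>
  On the monomial \<open>M\<close>, the coproduct \<open>A_coprod I J\<close> is the tensor product of \<open>mon_restrict M I\<close> and
  \<open>mon_ideal_restrict M J\<close> if \<open>mon_ideal M J\<close>, and \<open>0\<close> otherwise (\<open>A_coprod_basis\<close> below).
\<close>

definition mon_ideal :: "'x monomial \<Rightarrow> 'x set \<Rightarrow> bool" where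
  "mon_ideal M J \<longleftrightarrow> (\<forall>\<pi>\<in>#M. is_ideal \<pi> (J \<inter> index_set \<pi>))"

definition mon_restrict :: "'x monomial \<Rightarrow> 'x set \<Rightarrow> 'x monomial" where
  "mon_restrict M I = (\<Sum>\<pi>\<in>#M. restrict_mon \<pi> (I \<inter> index_set \<pi>))"

definition mon_ideal_restrict :: "'x monomial \<Rightarrow> 'x set \<Rightarrow> 'x monomial" where
  "mon_ideal_restrict M J = (\<Sum>\<pi>\<in>#M. ideal_restrict_mon \<pi> (J \<inter> index_set \<pi>))"

lemma mon_empty [simp]:
  "mon_ideal {#} J" "mon_restrict {#} J = {#}" "mon_ideal_restrict {#} J = {#}"
  by (simp_all add: mon_ideal_def mon_restrict_def mon_ideal_restrict_def)

lemma mon_add [simp]: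
  "mon_ideal (M + N) J \<longleftrightarrow> mon_ideal M J \<and> mon_ideal N J"
  "mon_restrict (M + N) J = mon_restrict M J + mon_restrict N J"
  "mon_ideal_restrict (M + N) J = mon_ideal_restrict M J + mon_ideal_restrict N J"
  by (auto simp: mon_ideal_def mon_restrict_def mon_ideal_restrict_def)

lemma mon_single [simp]:
  "mon_ideal {#\<pi>#} J \<longleftrightarrow> is_ideal \<pi> (J \<inter> index_set \<pi>)"
  "mon_restrict {#\<pi>#} J = restrict_mon \<pi> (J \<inter> index_set \<pi>)"
  "mon_ideal_restrict {#\<pi>#} J = ideal_restrict_mon \<pi> (J \<inter> index_set \<pi>)"
  by (simp_all add: mon_ideal_def mon_restrict_def mon_ideal_restrict_def)

lemma mon_sum_mset:
  "mon_ideal (\<Sum>\<pi>\<in>#M. f \<pi>) J \<longleftrightarrow> (\<forall>\<pi>\<in>#M. mon_ideal (f \<pi>) J)"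
  "mon_restrict (\<Sum>\<pi>\<in>#M. f \<pi>) J = (\<Sum>\<pi>\<in>#M. mon_restrict (f \<pi>) J)"
  "mon_ideal_restrict (\<Sum>\<pi>\<in>#M. f \<pi>) J = (\<Sum>\<pi>\<in>#M. mon_ideal_restrict (f \<pi>) J)"
  by (induction M) auto

lemma mon_sum:
  assumes "finite S"
  shows "mon_ideal (\<Sum>W\<in>S. f W) J \<longleftrightarrow> (\<forall>W\<in>S. mon_ideal (f W) J)"
    and "mon_restrict (\<Sum>W\<in>S. f W) J = (\<Sum>W\<in>S. mon_restrict (f W) J)"
    and "mon_ideal_restrict (\<Sum>W\<in>S. f W) J = (\<Sum>W\<in>S. mon_ideal_restrict (f W) J)"
  using assms by (induction S rule: finite_induct) auto

text \<open>
  The coproduct of a product uses the traces of \<open>I\<close> and \<open>J\<close> on the index sets of the factors; only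
  these traces matter.
\<close>

lemma mon_Int:
  assumes "\<And>\<pi>. \<pi> \<in># M \<Longrightarrow> index_set \<pi> \<subseteq> X"
  shows "mon_ideal M (J \<inter> X) \<longleftrightarrow> mon_ideal M J"
    and "mon_restrict M (J \<inter> X) = mon_restrict M J"
    and "mon_ideal_restrict M (J \<inter> X) = mon_ideal_restrict M J"
proof -
  have eq: "J \<inter> X \<inter> index_set \<pi> = J \<inter> index_set \<pi>" if "\<pi> \<in># M" for \<pi>
    using assms[OF that] by blast
  show "mon_ideal M (J \<inter> X) \<longleftrightarrow> mon_ideal M J"
    by (simp add: mon_ideal_def eq)
  show "mon_restrict M (J \<inter> X) = mon_restrict M J"
    unfolding mon_restrict_def by (intro arg_cong[of _ _ sum_mset] image_mset_cong) (simp add: eq)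
  show "mon_ideal_restrict M (J \<inter> X) = mon_ideal_restrict M J"
    unfolding mon_ideal_restrict_def by (intro arg_cong[of _ _ sum_mset] image_mset_cong) (simp add: eq)
qed

lemma restrict_mon_empty [simp]: "restrict_mon \<pi> {} = {#}"
  by (simp add: restrict_mon_def)

lemma linked_classes_empty [simp]: "linked_classes \<pi> A {} = {}"
  by (simp add: linked_classes_def)

text \<open>
  This lemma and the next two express a second coproduct, applied to a restriction \<open>\<pi>\<^bsub>|Y\<^esub>\<close>, in terms of
  \<open>\<pi>\<close>. The obstacles are the remaining blocks of \<open>Y\<close>, no longer all the remaining blocks of \<open>\<pi>\<close>.
\<close>

lemma mon_ideal_restrict_mon:
  assumes \<pi>: "\<pi> \<in> indexed_ncp X" and Y: "Y \<subseteq> X"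
  shows "mon_ideal (restrict_mon \<pi> Y) J \<longleftrightarrow> (\<forall>x\<in>J \<inter> Y. linked \<pi> (Y - J) x x)"
proof (cases "Y = {}")
  case False
  note r = ncp_restrict_in_indexed_ncp[OF \<pi> Y False]
  have "mon_ideal (restrict_mon \<pi> Y) J \<longleftrightarrow> is_ideal (ncp_restrict \<pi> Y) (J \<inter> Y)"
    using False by (simp add: restrict_mon_def indexed_ncp_index_set[OF r])
  also have "\<dots> \<longleftrightarrow> (\<forall>x\<in>J \<inter> Y. linked (ncp_restrict \<pi> Y) (Y - J \<inter> Y) x x)"
    by (simp add: is_ideal_iff_linked[OF r])
  also have "Y - J \<inter> Y = Y - J" by blast
  also have "(\<forall>x\<in>J \<inter> Y. linked (ncp_restrict \<pi> Y) (Y - J) x x) \<longleftrightarrow> (\<forall>x\<in>J \<inter> Y. linked \<pi> (Y - J) x x)"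
    by (intro ball_cong refl linked_ncp_restrict[OF \<pi> Y]) auto
  finally show ?thesis .
qed simp

lemma mon_restrict_restrict_mon:
  assumes \<pi>: "\<pi> \<in> indexed_ncp X" and Y: "Y \<subseteq> X"
  shows "mon_restrict (restrict_mon \<pi> Y) I = restrict_mon \<pi> (I \<inter> Y)"
proof (cases "Y = {}")
  case False
  note r = ncp_restrict_in_indexed_ncp[OF \<pi> Y False]
  show ?thesis
    using False ncp_restrict_ncp_restrict[OF \<pi> _ Y, of "I \<inter> Y"]
    by (simp add: restrict_mon_def indexed_ncp_index_set[OF r])
qed simp

lemma mon_ideal_restrict_restrict_mon:
  assumes \<pi>: "\<pi> \<in> indexed_ncp X" and Y: "Y \<subseteq> X" and id: "mon_ideal (restrict_mon \<pi> Y) J"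
  shows "mon_ideal_restrict (restrict_mon \<pi> Y) J =
    image_mset (ncp_restrict \<pi>) (mset_set (linked_classes \<pi> (Y - J) (J \<inter> Y)))"
proof (cases "Y = {}")
  case False
  note r = ncp_restrict_in_indexed_ncp[OF \<pi> Y False]
  have id': "is_ideal (ncp_restrict \<pi> Y) (J \<inter> Y)"
    using id False by (simp add: restrict_mon_def indexed_ncp_index_set[OF r])
  have YJ: "Y - J \<inter> Y = Y - J" by blast
  have "finite (J \<inter> Y)" using indexed_ncp_finite[OF r] by simp
  then have fin: "finite (linked_classes \<pi> (Y - J) (J \<inter> Y))"
    by (simp add: linked_classes_def)
  have "mon_ideal_restrict (restrict_mon \<pi> Y) J = ideal_restrict_mon (ncp_restrict \<pi> Y) (J \<inter> Y)"
    using False by (simp add: restrict_mon_def indexed_ncp_index_set[OF r])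
  also have "\<dots> = image_mset (ncp_restrict (ncp_restrict \<pi> Y))
      (mset_set (linked_classes (ncp_restrict \<pi> Y) (Y - J) (J \<inter> Y)))"
    unfolding ideal_restrict_mon_linked_classes[OF r id'] YJ ..
  also have "linked_classes (ncp_restrict \<pi> Y) (Y - J) (J \<inter> Y) = linked_classes \<pi> (Y - J) (J \<inter> Y)"
    by (rule linked_classes_ncp_restrict[OF \<pi> Y]) auto
  also have "image_mset (ncp_restrict (ncp_restrict \<pi> Y)) (mset_set (linked_classes \<pi> (Y - J) (J \<inter> Y))) =
      image_mset (ncp_restrict \<pi>) (mset_set (linked_classes \<pi> (Y - J) (J \<inter> Y)))"
  proof (rule image_mset_cong)
    fix W assume "W \<in># mset_set (linked_classes \<pi> (Y - J) (J \<inter> Y))"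
    then have "W \<subseteq> Y" using fin by (auto simp: linked_classes_def)
    then show "ncp_restrict (ncp_restrict \<pi> Y) W = ncp_restrict \<pi> W"
      by (rule ncp_restrict_ncp_restrict[OF \<pi> _ Y])
  qed
  finally show ?thesis .
qed simp

lemma ideal_restrict_mon_sum:
  assumes \<pi>: "\<pi> \<in> indexed_ncp X" and id: "is_ideal \<pi> J"
  shows "ideal_restrict_mon \<pi> J = (\<Sum>W\<in>linked_classes \<pi> (X - J) J. restrict_mon \<pi> W)"
proof -
  have J: "J \<subseteq> X" "\<And>x. x \<in> J \<Longrightarrow> linked \<pi> (X - J) x x"
    using id is_ideal_iff_linked[OF \<pi>] by blast+
  have "finite (linked_classes \<pi> (X - J) J)"
    using finite_subset[OF J(1) indexed_ncp_finite[OF \<pi>]] by (simp add: linked_classes_def)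
  then have "ideal_restrict_mon \<pi> J = (\<Sum>W\<in>linked_classes \<pi> (X - J) J. {#ncp_restrict \<pi> W#})"
    unfolding ideal_restrict_mon_linked_classes[OF \<pi> id] by (rule sum_singleton_mset[symmetric])
  also have "\<dots> = (\<Sum>W\<in>linked_classes \<pi> (X - J) J. restrict_mon \<pi> W)"
    using J(2) by (intro sum.cong) (auto simp: linked_classes_def restrict_mon_def)
  finally show ?thesis .
qed

section \<open>Coassociativity for one noncrossing partition\<close>

lemma image_mset_sum: "image_mset g (\<Sum>W\<in>C. f W) = (\<Sum>W\<in>C. image_mset g (f W))"
  by (induction C rule: infinite_finite_induct) simp_all

lemma mset_set_UN_disjoint:
  assumes "finite C" "\<And>W. W \<in> C \<Longrightarrow> finite (F W)"
    and "\<And>V W. V \<in> C \<Longrightarrow> W \<in> C \<Longrightarrow> V \<noteq> W \<Longrightarrow> F V \<inter> F W = {}"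
  shows "mset_set (\<Union>W\<in>C. F W) = (\<Sum>W\<in>C. mset_set (F W))"
  using assms
proof (induction C rule: finite_induct)
  case (insert V C)
  have "F V \<inter> (\<Union>W\<in>C. F W) = {}"
    using insert.prems(2)[of V] insert.hyps(2) by fastforce
  then show ?case
    using insert by (simp add: mset_set_Union)
qed simp

text \<open>
  More obstacles make the linked classes smaller, so the classes for the larger set \<open>B\<close> can be found
  inside each class for \<open>A\<close> separately. That the classes of \<open>S\<close> inside distinct \<open>W\<close> are distinct, and
  not only that they cover the same blocks, is what gives an identity of multisets.
\<close>

lemma linked_classes_refine:
  assumes \<pi>: "\<pi> \<in> indexed_ncp X" and T: "T \<subseteq> X" "\<And>x. x \<in> T \<Longrightarrow> linked \<pi> A x x"
    and S: "S \<subseteq> T" "A \<subseteq> B" "\<And>x. x \<in> S \<Longrightarrow> linked \<pi> B x x"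
  shows "mset_set (linked_classes \<pi> B S) =
    (\<Sum>W\<in>linked_classes \<pi> A T. mset_set (linked_classes \<pi> B (S \<inter> W)))"
proof -
  let ?C = "linked_classes \<pi> A T"
  let ?h = "\<lambda>x. {y \<in> S. linked \<pi> B x y}"
  have finT: "finite T" using finite_subset[OF T(1) indexed_ncp_finite[OF \<pi>]] .
  have part: "partition_on T ?C" using linked_classes_partition_on[OF \<pi> T] .
  have ne: "\<pi> x \<noteq> {}" if "x \<in> T" for x
    using that T(1) indexed_ncp_block_nonempty[OF \<pi>] by blast
  have same: "y \<in> W" if W: "W \<in> ?C" and xy: "x \<in> W" "y \<in> T" "linked \<pi> A x y" for W x y
  proof -
    obtain w where w: "W = {y \<in> T. linked \<pi> A w y}" using W unfolding linked_classes_def by blast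
    then have "linked \<pi> A w x" "x \<in> T" using xy(1) by simp_all
    then have "linked \<pi> A w y" using linked_trans[OF _ xy(3) ne] by blast
    then show ?thesis using w xy(2) by simp
  qed
  have F: "linked_classes \<pi> B (S \<inter> W) = ?h ` (S \<inter> W)" if W: "W \<in> ?C" for W
    unfolding linked_classes_def
  proof (rule image_cong[OF refl])
    fix x assume x: "x \<in> S \<inter> W"
    have "y \<in> W" if "y \<in> S" "linked \<pi> B x y" for y
      using same[OF W _ _ linked_antimono[OF that(2) S(2)]] x that(1) S(1) by blast
    then show "{y \<in> S \<inter> W. linked \<pi> B x y} = ?h x" by blast
  qed
  have "mset_set (\<Union>W\<in>?C. ?h ` (S \<inter> W)) = (\<Sum>W\<in>?C. mset_set (?h ` (S \<inter> W)))"
  proof (rule mset_set_UN_disjoint)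
    show "finite ?C" using finT by (simp add: linked_classes_def)
    show "finite (?h ` (S \<inter> W))" for W using finite_subset[OF S(1) finT] by simp
    fix V W assume VW: "V \<in> ?C" "W \<in> ?C" "V \<noteq> W"
    have dis: "V \<inter> W = {}" using part VW by (auto simp: partition_on_def disjoint_def)
    have "?h x \<noteq> ?h y" if "x \<in> S \<inter> V" "y \<in> S \<inter> W" for x y
    proof
      assume "?h x = ?h y"
      moreover have "y \<in> ?h y" using S(3) that by simp
      ultimately have "linked \<pi> B x y" by blast
      then have "y \<in> V" using same[OF VW(1), of x y] linked_antimono[OF _ S(2)] that S(1) by blast
      then show False using dis that by blast
    qed
    then show "?h ` (S \<inter> V) \<inter> ?h ` (S \<inter> W) = {}" by blast
  qed
  moreover have "(\<Union>W\<in>?C. ?h ` (S \<inter> W)) = linked_classes \<pi> B S"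
  proof -
    have "(\<Union>W\<in>?C. S \<inter> W) = S" using part S(1) unfolding partition_on_def by blast
    then show ?thesis unfolding image_UN[symmetric] by (simp add: linked_classes_def)
  qed
  ultimately show ?thesis using F by simp
qed

context
  fixes \<pi> :: "'x block_family" and X I J K :: "'x set"
  assumes \<pi>: "\<pi> \<in> indexed_ncp X" and X: "X = I \<union> J \<union> K"
    and disj: "I \<inter> J = {}" "I \<inter> K = {}" "J \<inter> K = {}"
begin

lemma coassoc_sets:
  "X - K = I \<union> J" "X - (J \<union> K) = I" "I \<union> J - J = I" "J \<inter> (I \<union> J) = J"
  "I \<union> J \<subseteq> X" "J \<union> K \<subseteq> X" "K \<subseteq> X" "J \<subseteq> X" "I \<subseteq> X" "I \<inter> (I \<union> J) = I"
  using X disj by blast+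

text \<open>
  Inside one class \<open>W\<close> of the ideal \<open>J \<union> K\<close>, obstacles from \<open>I\<close> do not occur, and by
  \<open>linked_between\<close> a block of \<open>J\<close> that separates two blocks of \<open>W\<close> is itself in \<open>W\<close>. So the
  obstacles in \<open>W - K\<close> already are all the relevant ones from \<open>I \<union> J\<close>.
\<close>

lemma linked_within_class:
  assumes T: "\<And>x. x \<in> J \<union> K \<Longrightarrow> linked \<pi> I x x"
    and W: "W \<in> linked_classes \<pi> I (J \<union> K)" and xy: "x \<in> W" "y \<in> W"
  shows "linked \<pi> (W - K) x y \<longleftrightarrow> linked \<pi> (I \<union> J) x y"
proof -
  obtain w where w: "W = {y \<in> J \<union> K. linked \<pi> I w y}" "w \<in> J \<union> K"
    using W unfolding linked_classes_def by blast
  have ne: "\<pi> u \<noteq> {}" if "u \<in> J \<union> K" for u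
    using that coassoc_sets(6) indexed_ncp_block_nonempty[OF \<pi>] by blast
  have wx: "linked \<pi> I w x" "linked \<pi> I w y" "x \<in> J \<union> K" using xy w(1) by simp_all
  have xyI: "linked \<pi> I x y" using linked_trans[OF linked_sym[OF wx(1)] wx(2) ne[OF w(2)]] .
  show ?thesis
  proof
    assume "linked \<pi> (I \<union> J) x y"
    then show "linked \<pi> (W - K) x y" by (rule linked_antimono) (use w(1) in blast)
  next
    assume l: "linked \<pi> (W - K) x y"
    show "linked \<pi> (I \<union> J) x y"
      unfolding linked_def
    proof (intro ballI)
      fix z r p q assume a: "z \<in> I \<union> J" "r \<in> \<pi> z" "p \<in> \<pi> x" "q \<in> \<pi> y"
      show "\<not> (p \<le> r \<and> r \<le> q) \<and> \<not> (q \<le> r \<and> r \<le> p)"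
      proof (rule ccontr)
        assume "\<not> (\<not> (p \<le> r \<and> r \<le> q) \<and> \<not> (q \<le> r \<and> r \<le> p))"
        then have btw: "p \<le> r \<and> r \<le> q \<or> q \<le> r \<and> r \<le> p" by blast
        then have z: "z \<in> J" using a xyI unfolding linked_def by blast
        have "linked \<pi> I x z"
          using linked_between[OF xyI T T a(2,3,4) btw] z wx(3) by blast
        then have "linked \<pi> I w z" using linked_trans[OF wx(1) _ ne[OF wx(3)]] by blast
        then have "z \<in> W - K" using z w(1) disj(3) by blast
        then show False using l a(2-4) btw unfolding linked_def by blast
      qed
    qed
  qed
qed

text \<open>
  Both sides say that all blocks of \<open>J\<close> are self-linked with respect to \<open>I\<close> and all blocks of \<open>K\<close> with
  respect to \<open>I \<union> J\<close>. The self-linkage of \<open>K\<close> with respect to \<open>I\<close>, which is explicit on the right, follows by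
  \<open>linked_antimono\<close> on the left.
\<close>

lemma coassoc_ideal:
  "is_ideal \<pi> K \<and> mon_ideal (restrict_mon \<pi> (I \<union> J)) J \<longleftrightarrow>
   is_ideal \<pi> (J \<union> K) \<and> mon_ideal (ideal_restrict_mon \<pi> (J \<union> K)) K"
proof -
  let ?C = "linked_classes \<pi> I (J \<union> K)"
  have finC: "finite ?C"
    using finite_subset[OF coassoc_sets(6) indexed_ncp_finite[OF \<pi>]] by (simp add: linked_classes_def)
  have K: "is_ideal \<pi> K \<longleftrightarrow> (\<forall>x\<in>K. linked \<pi> (I \<union> J) x x)"
    using is_ideal_iff_linked[OF \<pi>, of K] coassoc_sets by simp
  have J: "mon_ideal (restrict_mon \<pi> (I \<union> J)) J \<longleftrightarrow> (\<forall>x\<in>J. linked \<pi> I x x)"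
    using mon_ideal_restrict_mon[OF \<pi> coassoc_sets(5), of J] by (simp add: coassoc_sets)
  have JK: "is_ideal \<pi> (J \<union> K) \<longleftrightarrow> (\<forall>x\<in>J \<union> K. linked \<pi> I x x)"
    using is_ideal_iff_linked[OF \<pi>, of "J \<union> K"] coassoc_sets by simp
  have mi: "mon_ideal (ideal_restrict_mon \<pi> (J \<union> K)) K \<longleftrightarrow> (\<forall>x\<in>K. linked \<pi> (I \<union> J) x x)"
    if T: "is_ideal \<pi> (J \<union> K)"
  proof -
    have T': "\<And>x. x \<in> J \<union> K \<Longrightarrow> linked \<pi> I x x" using T JK by blast
    have part: "partition_on (J \<union> K) ?C"
      using linked_classes_partition_on[OF \<pi> coassoc_sets(6) T'] .
    have WX: "W \<subseteq> X" if "W \<in> ?C" for W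
      using that coassoc_sets(6) unfolding linked_classes_def by blast
    have "mon_ideal (ideal_restrict_mon \<pi> (J \<union> K)) K \<longleftrightarrow> (\<forall>W\<in>?C. mon_ideal (restrict_mon \<pi> W) K)"
      unfolding ideal_restrict_mon_sum[OF \<pi> T] coassoc_sets(2) by (rule mon_sum(1)[OF finC])
    also have "\<dots> \<longleftrightarrow> (\<forall>W\<in>?C. \<forall>x\<in>K \<inter> W. linked \<pi> (W - K) x x)"
      by (intro ball_cong refl mon_ideal_restrict_mon[OF \<pi>] WX)
    also have "\<dots> \<longleftrightarrow> (\<forall>W\<in>?C. \<forall>x\<in>K \<inter> W. linked \<pi> (I \<union> J) x x)"
      by (intro ball_cong refl linked_within_class[OF T']) blast+
    also have "\<dots> \<longleftrightarrow> (\<forall>x\<in>\<Union>?C. x \<in> K \<longrightarrow> linked \<pi> (I \<union> J) x x)" by blast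
    also have "\<Union>?C = J \<union> K" using part by (simp add: partition_on_def)
    finally show ?thesis by blast
  qed
  have "linked \<pi> I x x" if "linked \<pi> (I \<union> J) x x" for x
    using linked_antimono[OF that] by blast
  then show ?thesis using K J JK mi by blast
qed

text \<open>
  Both equations compare the linked classes of a part of \<open>J \<union> K\<close> with those found in each class \<open>W\<close>
  of \<open>J \<union> K\<close>, using \<open>linked_classes_refine\<close>. For \<open>J\<close> the obstacles \<open>I\<close> are the same on both levels, so
  \<open>W\<close> contributes the single class \<open>J \<inter> W\<close>, or none if this is empty; for \<open>K\<close> they increase from \<open>I\<close>
  to \<open>I \<union> J\<close>.
\<close>

lemma coassoc_restrict:
  assumes id: "is_ideal \<pi> K" "mon_ideal (restrict_mon \<pi> (I \<union> J)) J"
  shows "mon_ideal_restrict (restrict_mon \<pi> (I \<union> J)) J = mon_restrict (ideal_restrict_mon \<pi> (J \<union> K)) J"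
    and "ideal_restrict_mon \<pi> K = mon_ideal_restrict (ideal_restrict_mon \<pi> (J \<union> K)) K"
proof -
  let ?C = "linked_classes \<pi> I (J \<union> K)"
  have id': "is_ideal \<pi> (J \<union> K)" "mon_ideal (ideal_restrict_mon \<pi> (J \<union> K)) K"
    using coassoc_ideal id by blast+
  have finC: "finite ?C"
    using finite_subset[OF coassoc_sets(6) indexed_ncp_finite[OF \<pi>]] by (simp add: linked_classes_def)
  have T: "\<And>x. x \<in> J \<union> K \<Longrightarrow> linked \<pi> I x x"
    using is_ideal_iff_linked[OF \<pi>, of "J \<union> K"] id'(1) coassoc_sets(2) by simp
  have K: "\<And>x. x \<in> K \<Longrightarrow> linked \<pi> (I \<union> J) x x"
    using is_ideal_iff_linked[OF \<pi>, of K] id(1) coassoc_sets(1) by simp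
  have WX: "W \<subseteq> X" if "W \<in> ?C" for W
    using that coassoc_sets(6) unfolding linked_classes_def by blast
  have split: "ideal_restrict_mon \<pi> (J \<union> K) = (\<Sum>W\<in>?C. restrict_mon \<pi> W)"
    unfolding ideal_restrict_mon_sum[OF \<pi> id'(1)] coassoc_sets(2) ..
  \<comment> \<open>Any two blocks of \<open>W\<close> are linked with respect to \<open>I\<close>, so \<open>J \<inter> W\<close> is not divided further.\<close>
  have piece: "image_mset (ncp_restrict \<pi>) (mset_set (linked_classes \<pi> I (J \<inter> W))) =
      mon_restrict (restrict_mon \<pi> W) J" if W: "W \<in> ?C" for W
  proof -
    obtain w where w: "W = {y \<in> J \<union> K. linked \<pi> I w y}" "w \<in> J \<union> K"
      using W unfolding linked_classes_def by blast
    have "\<pi> w \<noteq> {}" using w(2) coassoc_sets(6) indexed_ncp_block_nonempty[OF \<pi>] by blast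
    then have "linked \<pi> I x y" if "x \<in> W" "y \<in> W" for x y
      using linked_trans[of \<pi> I x w y] linked_sym[of \<pi> I w x] that w(1) by simp
    then have "{y \<in> J \<inter> W. linked \<pi> I x y} = J \<inter> W" if "x \<in> J \<inter> W" for x
      using that by blast
    then have "linked_classes \<pi> I (J \<inter> W) = (\<lambda>x. J \<inter> W) ` (J \<inter> W)"
      unfolding linked_classes_def by (rule image_cong[OF refl])
    also have "\<dots> = (if J \<inter> W = {} then {} else {J \<inter> W})"
      by (rule image_constant_conv)
    finally show ?thesis
      unfolding mon_restrict_restrict_mon[OF \<pi> WX[OF W]] by (simp add: restrict_mon_def)
  qed
  have "mon_ideal_restrict (restrict_mon \<pi> (I \<union> J)) J =
      image_mset (ncp_restrict \<pi>) (mset_set (linked_classes \<pi> I J))"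
    using mon_ideal_restrict_restrict_mon[OF \<pi> coassoc_sets(5) id(2)] by (simp only: coassoc_sets)
  also have "\<dots> = (\<Sum>W\<in>?C. image_mset (ncp_restrict \<pi>) (mset_set (linked_classes \<pi> I (J \<inter> W))))"
    by (subst linked_classes_refine[OF \<pi> coassoc_sets(6) T, of J I]) (use T in \<open>auto simp: image_mset_sum\<close>)
  also have "\<dots> = (\<Sum>W\<in>?C. mon_restrict (restrict_mon \<pi> W) J)"
    by (rule sum.cong[OF refl piece])
  also have "\<dots> = mon_restrict (ideal_restrict_mon \<pi> (J \<union> K)) J"
    unfolding split by (rule mon_sum(2)[OF finC, symmetric])
  finally show "mon_ideal_restrict (restrict_mon \<pi> (I \<union> J)) J = mon_restrict (ideal_restrict_mon \<pi> (J \<union> K)) J" .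
  have pieceK: "image_mset (ncp_restrict \<pi>) (mset_set (linked_classes \<pi> (I \<union> J) (K \<inter> W))) =
      mon_ideal_restrict (restrict_mon \<pi> W) K" if W: "W \<in> ?C" for W
  proof -
    have "mon_ideal (restrict_mon \<pi> W) K"
      using id'(2) W unfolding split mon_sum(1)[OF finC] by blast
    then have "mon_ideal_restrict (restrict_mon \<pi> W) K =
        image_mset (ncp_restrict \<pi>) (mset_set (linked_classes \<pi> (W - K) (K \<inter> W)))"
      by (rule mon_ideal_restrict_restrict_mon[OF \<pi> WX[OF W]])
    also have "linked_classes \<pi> (W - K) (K \<inter> W) = linked_classes \<pi> (I \<union> J) (K \<inter> W)"
      unfolding linked_classes_def
      using linked_within_class[OF T W] by (intro image_cong refl Collect_cong) blast
    finally show ?thesis ..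
  qed
  have "ideal_restrict_mon \<pi> K = image_mset (ncp_restrict \<pi>) (mset_set (linked_classes \<pi> (I \<union> J) K))"
    unfolding ideal_restrict_mon_linked_classes[OF \<pi> id(1)] coassoc_sets(1) ..
  also have "\<dots> = (\<Sum>W\<in>?C. image_mset (ncp_restrict \<pi>) (mset_set (linked_classes \<pi> (I \<union> J) (K \<inter> W))))"
    by (subst linked_classes_refine[OF \<pi> coassoc_sets(6) T, of K "I \<union> J"]) (use K in \<open>auto simp: image_mset_sum\<close>)
  also have "\<dots> = (\<Sum>W\<in>?C. mon_ideal_restrict (restrict_mon \<pi> W) K)"
    by (rule sum.cong[OF refl pieceK])
  also have "\<dots> = mon_ideal_restrict (ideal_restrict_mon \<pi> (J \<union> K)) K"
    unfolding split by (rule mon_sum(3)[OF finC, symmetric])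
  finally show "ideal_restrict_mon \<pi> K = mon_ideal_restrict (ideal_restrict_mon \<pi> (J \<union> K)) K" .
qed

end

section \<open>The monomials of the species\<close>

lemma A_basis_empty: "A_basis {} = {{#}}"
proof -
  have "{#} \<in> A_basis {}"
    unfolding A_basis_def by (intro CollectI conjI exI[of _ "{}"]) (simp_all add: partition_on_empty)
  moreover have "M = {#}" if M: "M \<in> A_basis {}" for M :: "'a monomial"
  proof -
    obtain P where "partition_on {} P" "image_mset index_set M = mset_set P"
      using M unfolding A_basis_def by blast
    then show ?thesis by (simp add: partition_on_empty)
  qed
  ultimately show ?thesis by blast
qed

lemma A_basis_factor:
  assumes "M \<in> A_basis X" "\<pi> \<in># M"
  shows "\<pi> \<in> indexed_ncp (index_set \<pi>)" "index_set \<pi> \<subseteq> X"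
proof -
  show "\<pi> \<in> indexed_ncp (index_set \<pi>)" using assms unfolding A_basis_def by blast
  obtain P where P: "finite P" "partition_on X P" "image_mset index_set M = mset_set P"
    using assms(1) unfolding A_basis_def by blast
  have "index_set \<pi> \<in># image_mset index_set M" using assms(2) by simp
  then have "index_set \<pi> \<in> P" using P by simp
  then show "index_set \<pi> \<subseteq> X" using P(2) unfolding partition_on_def by blast
qed

lemma A_basis_partition:
  assumes "finite P" "partition_on X P" "\<And>Y. Y \<in> P \<Longrightarrow> f Y \<in> indexed_ncp Y"
  shows "image_mset f (mset_set P) \<in> A_basis X"
proof -
  have "index_set (f Y) = Y" if "Y \<in> P" for Y
    by (rule indexed_ncp_index_set[OF assms(3)[OF that]])
  then have "image_mset (\<lambda>Y. index_set (f Y)) (mset_set P) = image_mset (\<lambda>Y. Y) (mset_set P)"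
    using assms(1) by (intro image_mset_cong) simp
  then have "image_mset index_set (image_mset f (mset_set P)) = mset_set P"
    by (simp add: multiset.map_comp o_def)
  moreover have "\<pi> \<in> indexed_ncp (index_set \<pi>)" if "\<pi> \<in># image_mset f (mset_set P)" for \<pi>
    using that assms(1,3) indexed_ncp_index_set by fastforce
  ultimately show ?thesis using assms(1,2) unfolding A_basis_def by blast
qed

lemma restrict_mon_in_A_basis:
  assumes "\<pi> \<in> indexed_ncp X" "Y \<subseteq> X"
  shows "restrict_mon \<pi> Y \<in> A_basis Y"
proof (cases "Y = {}")
  case False
  have "image_mset (ncp_restrict \<pi>) (mset_set {Y}) \<in> A_basis Y"
    using ncp_restrict_in_indexed_ncp[OF assms False] partition_on_space[OF False]
    by (intro A_basis_partition) auto
  then show ?thesis using False by (simp add: restrict_mon_def)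
qed (simp add: A_basis_empty)

lemma ideal_restrict_mon_in_A_basis:
  assumes \<pi>: "\<pi> \<in> indexed_ncp X" and id: "is_ideal \<pi> J"
  shows "ideal_restrict_mon \<pi> J \<in> A_basis J"
proof -
  have J: "J \<subseteq> X" "\<And>x. x \<in> J \<Longrightarrow> linked \<pi> (X - J) x x"
    using id is_ideal_iff_linked[OF \<pi>] by blast+
  have part: "partition_on J (linked_classes \<pi> (X - J) J)"
    by (rule linked_classes_partition_on[OF \<pi> J])
  show ?thesis
    unfolding ideal_restrict_mon_linked_classes[OF \<pi> id]
  proof (rule A_basis_partition[OF _ part])
    show "finite (linked_classes \<pi> (X - J) J)"
      using finite_subset[OF J(1) indexed_ncp_finite[OF \<pi>]] by (simp add: linked_classes_def)
    fix Y assume Y: "Y \<in> linked_classes \<pi> (X - J) J"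
    then have "Y \<noteq> {}" "Y \<subseteq> J" using part unfolding partition_on_def by blast+
    then show "ncp_restrict \<pi> Y \<in> indexed_ncp Y"
      using J(1) by (intro ncp_restrict_in_indexed_ncp[OF \<pi>]) simp_all
  qed
qed

lemma A_basis_add:
  assumes "M \<in> A_basis X" "N \<in> A_basis Y" "X \<inter> Y = {}"
  shows "M + N \<in> A_basis (X \<union> Y)"
proof -
  obtain P where P: "finite P" "partition_on X P" "image_mset index_set M = mset_set P"
    using assms(1) unfolding A_basis_def by blast
  obtain Q where Q: "finite Q" "partition_on Y Q" "image_mset index_set N = mset_set Q"
    using assms(2) unfolding A_basis_def by blast
  have sub: "p \<subseteq> X" "p \<noteq> {}" if "p \<in> P" for p using P(2) that unfolding partition_on_def by blast+
  have subQ: "q \<subseteq> Y" "q \<noteq> {}" if "q \<in> Q" for q using Q(2) that unfolding partition_on_def by blast+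
  have dis: "p \<inter> q = {}" if "p \<in> P" "q \<in> Q" for p q using sub(1)[OF that(1)] subQ(1)[OF that(2)] assms(3) by blast
  have PQ: "P \<inter> Q = {}" using dis sub(2) by (metis disjoint_iff inf.idem)
  have "partition_on (X \<union> Y) (P \<union> Q)"
  proof (rule partition_onI)
    show "\<Union>(P \<union> Q) = X \<union> Y" using P(2) Q(2) by (simp add: partition_on_def)
    show "disjnt p q" if "p \<in> P \<union> Q" "q \<in> P \<union> Q" "p \<noteq> q" for p q
      using that dis partition_onD2[OF P(2)] partition_onD2[OF Q(2)]
      unfolding disjnt_def disjoint_def by (metis Un_iff inf_commute)
    show "{} \<notin> P \<union> Q" using sub(2) subQ(2) by blast
  qed
  moreover have "image_mset index_set (M + N) = mset_set (P \<union> Q)"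
    using P Q PQ by (simp add: mset_set_Union)
  moreover have "\<forall>\<pi>\<in>#M + N. \<pi> \<in> indexed_ncp (index_set \<pi>)"
    using A_basis_factor(1)[OF assms(1)] A_basis_factor(1)[OF assms(2)] by auto
  ultimately show ?thesis using P(1) Q(1) unfolding A_basis_def by blast
qed

lemma A_basis_add_mset:
  assumes "add_mset \<pi> N \<in> A_basis X"
  shows "N \<in> A_basis (X - index_set \<pi>)"
proof -
  obtain P where P: "finite P" "partition_on X P" "image_mset index_set (add_mset \<pi> N) = mset_set P"
    using assms unfolding A_basis_def by blast
  have "index_set \<pi> \<in># image_mset index_set (add_mset \<pi> N)" by simp
  then have inP: "index_set \<pi> \<in> P" unfolding P(3) using P(1) by simp
  then have "image_mset index_set N = mset_set (P - {index_set \<pi>})"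
    using P(1,3) by (simp add: mset_set_Diff) (metis add_mset_remove_trivial)
  moreover have "partition_on (X - index_set \<pi>) (P - {index_set \<pi>})"
  proof (rule partition_onI)
    show "\<Union>(P - {index_set \<pi>}) = X - index_set \<pi>"
      using P(2) inP by (auto simp: partition_on_def disjoint_def)
    show "disjnt p q" if "p \<in> P - {index_set \<pi>}" "q \<in> P - {index_set \<pi>}" "p \<noteq> q" for p q
      using that partition_onD2[OF P(2)] by (simp add: disjnt_def disjoint_def)
    show "{} \<notin> P - {index_set \<pi>}" using partition_onD3[OF P(2)] by blast
  qed
  moreover have "\<forall>\<rho>\<in>#N. \<rho> \<in> indexed_ncp (index_set \<rho>)"
    using A_basis_factor(1)[OF assms] by simp
  ultimately show ?thesis using P(1) unfolding A_basis_def by blast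
qed

text \<open>
  A family of monomials, one for each factor of \<open>M\<close> and with disjoint index sets, multiplies to a
  monomial. The coproduct of a monomial is computed factor by factor, so this is what places its two
  components in \<open>A_basis\<close>.
\<close>

lemma A_basis_sum_mset:
  assumes "M \<in> A_basis X" "\<And>\<pi>. \<pi> \<in># M \<Longrightarrow> f \<pi> \<in> A_basis (Y \<inter> index_set \<pi>)"
  shows "(\<Sum>\<pi>\<in>#M. f \<pi>) \<in> A_basis (Y \<inter> X)"
  using assms
proof (induction M arbitrary: X)
  case empty
  obtain P where P: "finite P" "partition_on X P" "image_mset index_set {#} = mset_set P"
    using empty.prems(1) unfolding A_basis_def by blast
  then have "P = {}" using mset_set_empty_iff[of P] by simp
  then have "X = {}" using partition_onD1[OF P(2)] by simp
  then show ?case by (simp add: A_basis_empty)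
next
  case (add \<pi> N)
  have "(\<Sum>\<pi>\<in>#N. f \<pi>) \<in> A_basis (Y \<inter> (X - index_set \<pi>))"
    using add.IH[OF A_basis_add_mset[OF add.prems(1)]] add.prems(2) by simp
  moreover have "f \<pi> \<in> A_basis (Y \<inter> index_set \<pi>)" using add.prems(2) by simp
  ultimately have "f \<pi> + (\<Sum>\<pi>\<in>#N. f \<pi>) \<in> A_basis (Y \<inter> index_set \<pi> \<union> Y \<inter> (X - index_set \<pi>))"
    by (intro A_basis_add) auto
  moreover have "Y \<inter> index_set \<pi> \<union> Y \<inter> (X - index_set \<pi>) = Y \<inter> X"
    using A_basis_factor(2)[OF add.prems(1), of \<pi>] by auto
  ultimately show ?case by simp
qed

lemma mon_restrict_in_A_basis:
  assumes M: "M \<in> A_basis X" and Y: "Y \<subseteq> X"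
  shows "mon_restrict M Y \<in> A_basis Y"
proof -
  have "(\<Sum>\<pi>\<in>#M. restrict_mon \<pi> (Y \<inter> index_set \<pi>)) \<in> A_basis (Y \<inter> X)"
    by (intro A_basis_sum_mset[OF M] restrict_mon_in_A_basis[OF A_basis_factor(1)[OF M]]) simp_all
  then show ?thesis using Y by (simp add: mon_restrict_def Int_absorb2)
qed

lemma mon_ideal_restrict_in_A_basis:
  assumes M: "M \<in> A_basis X" and Y: "Y \<subseteq> X" and id: "mon_ideal M Y"
  shows "mon_ideal_restrict M Y \<in> A_basis Y"
proof -
  have "(\<Sum>\<pi>\<in>#M. ideal_restrict_mon \<pi> (Y \<inter> index_set \<pi>)) \<in> A_basis (Y \<inter> X)"
    using id by (intro A_basis_sum_mset[OF M] ideal_restrict_mon_in_A_basis[OF A_basis_factor(1)[OF M]])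
      (simp_all add: mon_ideal_def)
  then show ?thesis using Y by (simp add: mon_ideal_restrict_def Int_absorb2)
qed

text \<open>
  The coassociativity of each factor \<open>\<pi>\<close>, with the traces \<open>i \<pi>\<close>, \<open>j \<pi>\<close>, \<open>k \<pi>\<close> of \<open>I\<close>, \<open>J\<close>, \<open>K\<close> on its
  index set. The factors obtained in the first step have index sets inside that of \<open>\<pi>\<close>, so \<open>mon_Int\<close> allows
  the same traces in the second step.
\<close>

lemma mon_coassoc:
  assumes M: "M \<in> A_basis (I \<union> J \<union> K)"
    and disj: "I \<inter> J = {}" "I \<inter> K = {}" "J \<inter> K = {}"
  shows "mon_ideal M K \<and> mon_ideal (mon_restrict M (I \<union> J)) J \<longleftrightarrow>
      mon_ideal M (J \<union> K) \<and> mon_ideal (mon_ideal_restrict M (J \<union> K)) K"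
    and "mon_restrict (mon_restrict M (I \<union> J)) I = mon_restrict M I"
    and "mon_ideal M K \<Longrightarrow> mon_ideal (mon_restrict M (I \<union> J)) J \<Longrightarrow>
      mon_ideal_restrict (mon_restrict M (I \<union> J)) J = mon_restrict (mon_ideal_restrict M (J \<union> K)) J"
    and "mon_ideal M K \<Longrightarrow> mon_ideal (mon_restrict M (I \<union> J)) J \<Longrightarrow>
      mon_ideal_restrict M K = mon_ideal_restrict (mon_ideal_restrict M (J \<union> K)) K"
proof -
  define i where "i \<pi> = I \<inter> index_set \<pi>" for \<pi> :: "'a block_family"
  define j where "j \<pi> = J \<inter> index_set \<pi>" for \<pi> :: "'a block_family"
  define k where "k \<pi> = K \<inter> index_set \<pi>" for \<pi> :: "'a block_family"
  have ncp: "\<pi> \<in> indexed_ncp (index_set \<pi>)" if "\<pi> \<in># M" for \<pi>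
    by (rule A_basis_factor(1)[OF M that])
  have X: "index_set \<pi> = i \<pi> \<union> j \<pi> \<union> k \<pi>" if "\<pi> \<in># M" for \<pi>
    using A_basis_factor(2)[OF M that] unfolding i_def j_def k_def by blast
  have dis: "i \<pi> \<inter> j \<pi> = {}" "i \<pi> \<inter> k \<pi> = {}" "j \<pi> \<inter> k \<pi> = {}" for \<pi>
    using disj unfolding i_def j_def k_def by blast+
  have Un: "(I \<union> J) \<inter> index_set \<pi> = i \<pi> \<union> j \<pi>" "(J \<union> K) \<inter> index_set \<pi> = j \<pi> \<union> k \<pi>" for \<pi>
    unfolding i_def j_def k_def by blast+
  have loc_r: "index_set \<rho> \<subseteq> index_set \<pi>"
    if "\<pi> \<in># M" "\<rho> \<in># restrict_mon \<pi> (i \<pi> \<union> j \<pi>)" for \<pi> \<rho>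
  proof -
    have "i \<pi> \<union> j \<pi> \<subseteq> index_set \<pi>" unfolding i_def j_def by blast
    then show ?thesis
      using A_basis_factor(2)[OF restrict_mon_in_A_basis[OF ncp[OF that(1)]] that(2)] by blast
  qed
  have loc_i: "index_set \<rho> \<subseteq> index_set \<pi>"
    if "\<pi> \<in># M" "is_ideal \<pi> (j \<pi> \<union> k \<pi>)" "\<rho> \<in># ideal_restrict_mon \<pi> (j \<pi> \<union> k \<pi>)" for \<pi> \<rho>
    using A_basis_factor(2)[OF ideal_restrict_mon_in_A_basis[OF ncp[OF that(1)] that(2)] that(3)]
    unfolding j_def k_def by blast
  have r: "mon_ideal (restrict_mon \<pi> (i \<pi> \<union> j \<pi>)) J \<longleftrightarrow> mon_ideal (restrict_mon \<pi> (i \<pi> \<union> j \<pi>)) (j \<pi>)"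
    "mon_ideal_restrict (restrict_mon \<pi> (i \<pi> \<union> j \<pi>)) J = mon_ideal_restrict (restrict_mon \<pi> (i \<pi> \<union> j \<pi>)) (j \<pi>)"
    "mon_restrict (restrict_mon \<pi> (i \<pi> \<union> j \<pi>)) I = mon_restrict (restrict_mon \<pi> (i \<pi> \<union> j \<pi>)) (i \<pi>)"
    if "\<pi> \<in># M" for \<pi>
    using mon_Int[of "restrict_mon \<pi> (i \<pi> \<union> j \<pi>)" "index_set \<pi>", OF loc_r[OF that]]
    unfolding i_def j_def by simp_all
  have ir: "mon_ideal (ideal_restrict_mon \<pi> (j \<pi> \<union> k \<pi>)) K \<longleftrightarrow> mon_ideal (ideal_restrict_mon \<pi> (j \<pi> \<union> k \<pi>)) (k \<pi>)"
    "mon_ideal_restrict (ideal_restrict_mon \<pi> (j \<pi> \<union> k \<pi>)) K = mon_ideal_restrict (ideal_restrict_mon \<pi> (j \<pi> \<union> k \<pi>)) (k \<pi>)"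
    "mon_restrict (ideal_restrict_mon \<pi> (j \<pi> \<union> k \<pi>)) J = mon_restrict (ideal_restrict_mon \<pi> (j \<pi> \<union> k \<pi>)) (j \<pi>)"
    if "\<pi> \<in># M" "is_ideal \<pi> (j \<pi> \<union> k \<pi>)" for \<pi>
    using mon_Int[of "ideal_restrict_mon \<pi> (j \<pi> \<union> k \<pi>)" "index_set \<pi>", OF loc_i[OF that]]
    unfolding j_def k_def by simp_all
  have R: "mon_restrict M (I \<union> J) = (\<Sum>\<pi>\<in>#M. restrict_mon \<pi> (i \<pi> \<union> j \<pi>))"
    unfolding mon_restrict_def Un ..
  have IR: "mon_ideal_restrict M (J \<union> K) = (\<Sum>\<pi>\<in>#M. ideal_restrict_mon \<pi> (j \<pi> \<union> k \<pi>))"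
    unfolding mon_ideal_restrict_def Un ..
  have idK: "mon_ideal M K \<longleftrightarrow> (\<forall>\<pi>\<in>#M. is_ideal \<pi> (k \<pi>))"
    and idJK: "mon_ideal M (J \<union> K) \<longleftrightarrow> (\<forall>\<pi>\<in>#M. is_ideal \<pi> (j \<pi> \<union> k \<pi>))"
    unfolding mon_ideal_def Un k_def by (rule refl)+
  have idR: "mon_ideal (mon_restrict M (I \<union> J)) J \<longleftrightarrow>
      (\<forall>\<pi>\<in>#M. mon_ideal (restrict_mon \<pi> (i \<pi> \<union> j \<pi>)) (j \<pi>))"
    unfolding R mon_sum_mset by (intro ball_cong refl r)
  have loc: "is_ideal \<pi> (k \<pi>) \<and> mon_ideal (restrict_mon \<pi> (i \<pi> \<union> j \<pi>)) (j \<pi>) \<longleftrightarrow>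
      is_ideal \<pi> (j \<pi> \<union> k \<pi>) \<and> mon_ideal (ideal_restrict_mon \<pi> (j \<pi> \<union> k \<pi>)) K" if "\<pi> \<in># M" for \<pi>
    using coassoc_ideal[OF ncp[OF that] X[OF that] dis] ir(1)[OF that] by blast
  show "mon_ideal M K \<and> mon_ideal (mon_restrict M (I \<union> J)) J \<longleftrightarrow>
      mon_ideal M (J \<union> K) \<and> mon_ideal (mon_ideal_restrict M (J \<union> K)) K"
    unfolding idR idK idJK IR mon_sum_mset ball_conj_distrib[symmetric]
    by (intro ball_cong refl loc)
  have "mon_restrict (restrict_mon \<pi> (i \<pi> \<union> j \<pi>)) I = restrict_mon \<pi> (i \<pi>)" if "\<pi> \<in># M" for \<pi>
  proof -
    have "i \<pi> \<union> j \<pi> \<subseteq> index_set \<pi>" "i \<pi> \<inter> (i \<pi> \<union> j \<pi>) = i \<pi>" unfolding i_def j_def by blast+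
    then show ?thesis using r(3)[OF that] mon_restrict_restrict_mon[OF ncp[OF that]] by simp
  qed
  then show "mon_restrict (mon_restrict M (I \<union> J)) I = mon_restrict M I"
    unfolding R mon_sum_mset
    unfolding mon_restrict_def[of M] i_def[symmetric]
    by (intro arg_cong[of _ _ sum_mset] image_mset_cong)
  assume id: "mon_ideal M K" "mon_ideal (mon_restrict M (I \<union> J)) J"
  have id1: "is_ideal \<pi> (k \<pi>)" "mon_ideal (restrict_mon \<pi> (i \<pi> \<union> j \<pi>)) (j \<pi>)" "is_ideal \<pi> (j \<pi> \<union> k \<pi>)"
    if "\<pi> \<in># M" for \<pi>
    using id that loc[OF that] unfolding idK idR by blast+
  show "mon_ideal_restrict (mon_restrict M (I \<union> J)) J = mon_restrict (mon_ideal_restrict M (J \<union> K)) J"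
    unfolding R IR mon_sum_mset
  proof (intro arg_cong[of _ _ sum_mset] image_mset_cong)
    fix \<pi> assume m: "\<pi> \<in># M"
    show "mon_ideal_restrict (restrict_mon \<pi> (i \<pi> \<union> j \<pi>)) J = mon_restrict (ideal_restrict_mon \<pi> (j \<pi> \<union> k \<pi>)) J"
      unfolding r(2)[OF m] ir(3)[OF m id1(3)[OF m]]
      by (rule coassoc_restrict(1)[OF ncp[OF m] X[OF m] dis id1(1,2)[OF m]])
  qed
  show "mon_ideal_restrict M K = mon_ideal_restrict (mon_ideal_restrict M (J \<union> K)) K"
    unfolding IR mon_sum_mset
    unfolding mon_ideal_restrict_def[of M] k_def[symmetric]
  proof (intro arg_cong[of _ _ sum_mset] image_mset_cong)
    fix \<pi> assume m: "\<pi> \<in># M"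
    show "ideal_restrict_mon \<pi> (k \<pi>) = mon_ideal_restrict (ideal_restrict_mon \<pi> (j \<pi> \<union> k \<pi>)) K"
      unfolding ir(2)[OF m id1(3)[OF m]]
      by (rule coassoc_restrict(2)[OF ncp[OF m] X[OF m] dis id1(1,2)[OF m]])
  qed
qed

section \<open>Relabelling\<close>

lemma index_set_relabel: "index_set (relabel \<sigma> \<pi>) = \<sigma> ` index_set \<pi>"
  unfolding index_set_def relabel_def by blast

lemma relabel_apply:
  assumes "inj_on \<sigma> (index_set \<pi>)" "x \<in> index_set \<pi>"
  shows "relabel \<sigma> \<pi> (\<sigma> x) = \<pi> x"
proof -
  have "\<pi> y = {} \<or> y = x" if "\<sigma> y = \<sigma> x" for y
    using that assms unfolding index_set_def inj_on_def by blast
  then show ?thesis unfolding relabel_def by blast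
qed

text \<open>
  The union in \<open>relabel\<close> ranges over preimages that may lie outside the index set; they contribute
  empty blocks.
\<close>

lemma relabel_cong:
  assumes "\<And>x. x \<in> index_set \<pi> \<Longrightarrow> \<sigma> x = \<tau> x"
  shows "relabel \<sigma> \<pi> = relabel \<tau> \<pi>"
proof
  fix y
  have "p \<in> relabel \<sigma> \<pi> y \<longleftrightarrow> p \<in> relabel \<tau> \<pi> y" for p
    using assms unfolding relabel_def index_set_def by fastforce
  then show "relabel \<sigma> \<pi> y = relabel \<tau> \<pi> y" by blast
qed

lemma relabel_ident: "relabel (\<lambda>x. x) = (\<lambda>\<pi>. \<pi>)"
  by (simp add: relabel_def fun_eq_iff)

lemma relabel_compose: "relabel (\<lambda>x. \<tau> (\<sigma> x)) = (\<lambda>\<pi>. relabel \<tau> (relabel \<sigma> \<pi>))"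
  unfolding relabel_def by (intro ext) auto

lemma UN_relabel:
  assumes "inj_on \<sigma> (index_set \<pi>)" "Y \<subseteq> index_set \<pi>"
  shows "(\<Union>y\<in>\<sigma> ` Y. relabel \<sigma> \<pi> y) = (\<Union>x\<in>Y. \<pi> x)"
proof -
  have "(\<Union>x\<in>Y. relabel \<sigma> \<pi> (\<sigma> x)) = (\<Union>x\<in>Y. \<pi> x)"
    by (rule SUP_cong[OF refl]) (rule relabel_apply[OF assms(1) subsetD[OF assms(2)]])
  then show ?thesis by simp
qed

lemma relabel_image:
  assumes "inj_on \<sigma> (index_set \<pi>)"
  shows "relabel \<sigma> \<pi> ` \<sigma> ` index_set \<pi> = \<pi> ` index_set \<pi>"
  unfolding image_image by (rule image_cong[OF refl]) (rule relabel_apply[OF assms])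

lemma relabel_in_indexed_ncp:
  assumes \<pi>: "\<pi> \<in> indexed_ncp X" and inj: "inj_on \<sigma> X"
  shows "relabel \<sigma> \<pi> \<in> indexed_ncp (\<sigma> ` X)"
proof -
  note ix = indexed_ncp_index_set[OF \<pi>]
  have im: "relabel \<sigma> \<pi> ` \<sigma> ` X = \<pi> ` X"
    using relabel_image[of \<sigma> \<pi>] inj ix by simp
  have "inj_on (relabel \<sigma> \<pi>) (\<sigma> ` X)"
  proof (rule inj_onI, elim imageE, hypsubst)
    fix x y assume a: "relabel \<sigma> \<pi> (\<sigma> x) = relabel \<sigma> \<pi> (\<sigma> y)" "x \<in> X" "y \<in> X"
    then have "\<pi> x = \<pi> y" using relabel_apply[of \<sigma> \<pi>] inj ix by simp
    moreover have "inj_on \<pi> X" using \<pi> by (simp add: indexed_ncp_def)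
    ultimately have "x = y" using a(2,3) by (simp add: inj_on_eq_iff)
    then show "\<sigma> x = \<sigma> y" by simp
  qed
  moreover have "relabel \<sigma> \<pi> y = {}" if "y \<notin> \<sigma> ` X" for y
    using that index_set_relabel[of \<sigma> \<pi>] ix unfolding index_set_def by blast
  moreover have "\<exists>n. noncrossing_partition n (relabel \<sigma> \<pi> ` \<sigma> ` X)"
    unfolding im using \<pi> unfolding indexed_ncp_def by blast
  ultimately show ?thesis unfolding indexed_ncp_def by blast
qed

lemma ncp_restrict_relabel:
  assumes inj: "inj_on \<sigma> (index_set \<pi>)" and Y: "Y \<subseteq> index_set \<pi>"
  shows "ncp_restrict (relabel \<sigma> \<pi>) (\<sigma> ` Y) = relabel \<sigma> (ncp_restrict \<pi> Y)"
proof
  fix y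
  let ?r = "rank (\<Union>x\<in>Y. \<pi> x)"
  show "ncp_restrict (relabel \<sigma> \<pi>) (\<sigma> ` Y) y = relabel \<sigma> (ncp_restrict \<pi> Y) y"
  proof (cases "y \<in> \<sigma> ` Y")
    case True
    then obtain x where x: "x \<in> Y" "y = \<sigma> x" by blast
    have "index_set (ncp_restrict \<pi> Y) \<subseteq> Y"
      by (auto simp: index_set_def ncp_restrict_rank)
    then have inj': "inj_on \<sigma> (index_set (ncp_restrict \<pi> Y))"
      using Y by (intro inj_on_subset[OF inj]) blast
    have "x \<in> index_set (ncp_restrict \<pi> Y)"
      using x Y by (auto simp: index_set_def ncp_restrict_rank)
    then have "relabel \<sigma> (ncp_restrict \<pi> Y) y = ?r ` \<pi> x"
      using relabel_apply[OF inj'] x by (simp add: ncp_restrict_rank)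
    moreover have "relabel \<sigma> \<pi> y = \<pi> x" using relabel_apply[OF inj subsetD[OF Y]] x by simp
    ultimately show ?thesis
      using True unfolding ncp_restrict_rank UN_relabel[OF inj Y] by simp
  next
    case False
    then show ?thesis by (auto simp: ncp_restrict_rank relabel_def)
  qed
qed

lemma restrict_mon_relabel:
  assumes "inj_on \<sigma> (index_set \<pi>)" "Y \<subseteq> index_set \<pi>"
  shows "restrict_mon (relabel \<sigma> \<pi>) (\<sigma> ` Y) = image_mset (relabel \<sigma>) (restrict_mon \<pi> Y)"
  by (simp add: restrict_mon_def ncp_restrict_relabel[OF assms])

lemma is_ideal_relabel:
  assumes inj: "inj_on \<sigma> (index_set \<pi>)" and J: "J \<subseteq> index_set \<pi>"
  shows "is_ideal (relabel \<sigma> \<pi>) (\<sigma> ` J) \<longleftrightarrow> is_ideal \<pi> J"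
  unfolding is_ideal_def index_set_relabel UN_relabel[OF assms] relabel_image[OF inj]
  using J by (simp add: image_mono)

lemma ideal_restrict_mon_relabel:
  assumes inj: "inj_on \<sigma> (index_set \<pi>)" and J: "J \<subseteq> index_set \<pi>"
  shows "ideal_restrict_mon (relabel \<sigma> \<pi>) (\<sigma> ` J) = image_mset (relabel \<sigma>) (ideal_restrict_mon \<pi> J)"
proof -
  have set: "{y \<in> \<sigma> ` J. relabel \<sigma> \<pi> y \<subseteq> C} = \<sigma> ` {x \<in> J. \<pi> x \<subseteq> C}" for C
  proof -
    have "relabel \<sigma> \<pi> (\<sigma> x) = \<pi> x" if "x \<in> J" for x
      by (rule relabel_apply[OF inj subsetD[OF J that]])
    then show ?thesis by force
  qed
  have "restrict_mon (relabel \<sigma> \<pi>) (\<sigma> ` {x \<in> J. \<pi> x \<subseteq> C}) =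
      image_mset (relabel \<sigma>) (restrict_mon \<pi> {x \<in> J. \<pi> x \<subseteq> C})" for C
    by (rule restrict_mon_relabel[OF inj]) (use J in blast)
  then show ?thesis
    unfolding ideal_restrict_mon_def UN_relabel[OF assms] set by (simp add: image_mset_sum)
qed

lemma image_mset_sum_mset: "image_mset g (\<Sum>\<pi>\<in>#M. f \<pi>) = (\<Sum>\<pi>\<in>#M. image_mset g (f \<pi>))"
  by (induction M) simp_all

lemma mon_relabel:
  assumes inj: "inj_on \<sigma> X" and M: "\<And>\<pi>. \<pi> \<in># M \<Longrightarrow> index_set \<pi> \<subseteq> X" and J: "J \<subseteq> X"
  shows "mon_ideal (image_mset (relabel \<sigma>) M) (\<sigma> ` J) \<longleftrightarrow> mon_ideal M J"
    and "mon_restrict (image_mset (relabel \<sigma>) M) (\<sigma> ` J) = image_mset (relabel \<sigma>) (mon_restrict M J)"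
    and "mon_ideal_restrict (image_mset (relabel \<sigma>) M) (\<sigma> ` J) =
      image_mset (relabel \<sigma>) (mon_ideal_restrict M J)"
proof -
  have i: "\<sigma> ` J \<inter> index_set (relabel \<sigma> \<pi>) = \<sigma> ` (J \<inter> index_set \<pi>)" "inj_on \<sigma> (index_set \<pi>)"
    if "\<pi> \<in># M" for \<pi>
    using inj_on_image_Int[OF inj J M[OF that]] inj_on_subset[OF inj M[OF that]]
    by (simp_all add: index_set_relabel)
  note s = Int_lower2[of J "index_set \<pi>" for \<pi> :: "'a block_family"]
  show "mon_ideal (image_mset (relabel \<sigma>) M) (\<sigma> ` J) \<longleftrightarrow> mon_ideal M J"
    using i(1) is_ideal_relabel[OF i(2) s] by (simp add: mon_ideal_def)
  have "image_mset (\<lambda>\<pi>. restrict_mon (relabel \<sigma> \<pi>) (\<sigma> ` J \<inter> index_set (relabel \<sigma> \<pi>))) M =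
      image_mset (\<lambda>\<pi>. image_mset (relabel \<sigma>) (restrict_mon \<pi> (J \<inter> index_set \<pi>))) M"
    using i(1) restrict_mon_relabel[OF i(2) s] by (intro image_mset_cong) simp
  then show "mon_restrict (image_mset (relabel \<sigma>) M) (\<sigma> ` J) = image_mset (relabel \<sigma>) (mon_restrict M J)"
    by (simp add: mon_restrict_def multiset.map_comp o_def image_mset_sum_mset)
  have "image_mset (\<lambda>\<pi>. ideal_restrict_mon (relabel \<sigma> \<pi>) (\<sigma> ` J \<inter> index_set (relabel \<sigma> \<pi>))) M =
      image_mset (\<lambda>\<pi>. image_mset (relabel \<sigma>) (ideal_restrict_mon \<pi> (J \<inter> index_set \<pi>))) M"
    using i(1) ideal_restrict_mon_relabel[OF i(2) s] by (intro image_mset_cong) simp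
  then show "mon_ideal_restrict (image_mset (relabel \<sigma>) M) (\<sigma> ` J) =
      image_mset (relabel \<sigma>) (mon_ideal_restrict M J)"
    by (simp add: mon_ideal_restrict_def multiset.map_comp o_def image_mset_sum_mset)
qed

lemma A_basis_relabel:
  assumes M: "M \<in> A_basis X" and inj: "inj_on \<sigma> X"
  shows "image_mset (relabel \<sigma>) M \<in> A_basis (\<sigma> ` X)"
proof -
  obtain P where P: "finite P" "partition_on X P" "image_mset index_set M = mset_set P"
    using M unfolding A_basis_def by blast
  have "P \<subseteq> Pow X" using P(2) unfolding partition_on_def by blast
  then have injP: "inj_on ((`) \<sigma>) P" using inj_on_image_Pow[OF inj] inj_on_subset by blast
  have "image_mset index_set (image_mset (relabel \<sigma>) M) = image_mset ((`) \<sigma>) (image_mset index_set M)"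
    by (simp add: multiset.map_comp o_def index_set_relabel)
  also have "\<dots> = mset_set ((`) \<sigma> ` P)"
    unfolding P(3) by (rule image_mset_mset_set[OF injP])
  finally have "image_mset index_set (image_mset (relabel \<sigma>) M) = mset_set ((`) \<sigma> ` P)" .
  moreover have "partition_on (\<sigma> ` X) ((`) \<sigma> ` P)"
    using partition_on_inj_image[OF P(2) inj] partition_onD3[OF P(2)] by (simp add: image_iff)
  moreover have "relabel \<sigma> \<pi> \<in> indexed_ncp (index_set (relabel \<sigma> \<pi>))" if "\<pi> \<in># M" for \<pi>
    using relabel_in_indexed_ncp[OF A_basis_factor(1)[OF M that]]
      inj_on_subset[OF inj A_basis_factor(2)[OF M that]] by (simp add: index_set_relabel)
  ultimately show ?thesis using P(1) unfolding A_basis_def by auto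
qed

section \<open>The twisted bialgebra\<close>

lemma A_act_basis [simp]: "A_act X \<sigma> (basis_vec M) = basis_vec (image_mset (relabel \<sigma>) M)"
  by (simp add: A_act_def)

lemma A_mult_basis [simp]: "A_mult X Y (basis_vec (M, N)) = basis_vec (M + N)"
  by (simp add: A_mult_def)

lemma A_coprod_basis:
  "A_coprod I J (basis_vec M) =
    (if mon_ideal M J then basis_vec (mon_restrict M I, mon_ideal_restrict M J) else 0)"
proof -
  have "(\<Prod>\<pi>\<in>#M. ncp_coprod (I \<inter> index_set \<pi>) (J \<inter> index_set \<pi>) \<pi>) =
    (if mon_ideal M J then basis_vec (mon_restrict M I, mon_ideal_restrict M J) else (0 :: _ \<Rightarrow>\<^sub>0 'b))"
  proof (induction M)
    case empty
    have "({#}, {#}) = (0 :: 'a monomial \<times> 'a monomial)" by (simp add: zero_prod_def)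
    then show ?case by simp
  next
    case (add \<pi> M)
    have "mon_ideal (add_mset \<pi> M) J \<longleftrightarrow> is_ideal \<pi> (J \<inter> index_set \<pi>) \<and> mon_ideal M J"
      by (simp add: mon_ideal_def)
    then show ?case
      using add.IH
      by (simp add: ncp_coprod_def mon_restrict_def mon_ideal_restrict_def mult_single)
  qed
  then show ?thesis by (simp add: A_coprod_def)
qed

lemma linear_maps:
  "linear_on UNIV UNIV (A_act X \<sigma>)" "linear_on UNIV UNIV (A_mult X Y)"
  "linear_on UNIV UNIV (A_coprod X Y)" "linear_on UNIV UNIV (tensor_map f g)"
  "linear_on UNIV UNIV tensor_assoc" "linear_on UNIV UNIV tensor_middle_flip"
  "linear_on UNIV UNIV (form_tensor_id e)" "linear_on UNIV UNIV (id_tensor_form e)"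
  unfolding A_act_def A_mult_def A_coprod_def tensor_map_def tensor_assoc_def tensor_middle_flip_def
    form_tensor_id_def id_tensor_form_def
  by (rule linear_lin_ext)+

lemmas linear_intros = linear_ident linear_maps[THEN linear_compose]
  tensor_left_linear tensor_right_linear

lemma linear_species_A: "linear_species A_basis (A_act :: 'x set \<Rightarrow> _ \<Rightarrow> _ \<Rightarrow> ('x monomial \<Rightarrow>\<^sub>0 'k::field))"
proof
  fix X :: "'x set" and \<sigma> \<tau> :: "'x \<Rightarrow> 'x" and v :: "'x monomial \<Rightarrow>\<^sub>0 'k"
  show "linear_on (A_basis X) (A_basis (\<sigma> ` X)) (A_act X \<sigma> :: _ \<Rightarrow> ('x monomial \<Rightarrow>\<^sub>0 'k))" if "inj_on \<sigma> X"
    unfolding A_act_def by (intro linear_on_lin_ext basis_vec_in_fspace A_basis_relabel that)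
  assume v: "v \<in> fspace (A_basis X)"
  show "A_act X id v = v"
    by (rule linear_eq_on_fspace[OF v]; (intro linear_intros)?) (simp add: relabel_ident id_def)
  show "A_act X (\<tau> \<circ> \<sigma>) v = A_act (\<sigma> ` X) \<tau> (A_act X \<sigma> v)"
    by (rule linear_eq_on_fspace[OF v]; (intro linear_intros)?)
      (simp add: multiset.map_comp o_def relabel_compose)
  show "A_act X \<sigma> v = A_act X \<tau> v" if st: "\<And>x. x \<in> X \<Longrightarrow> \<sigma> x = \<tau> x"
  proof (rule linear_eq_on_fspace[OF v]; (intro linear_intros)?)
    fix M :: "'x monomial" assume M: "M \<in> A_basis X"
    have "relabel \<sigma> \<pi> = relabel \<tau> \<pi>" if "\<pi> \<in># M" for \<pi>
      using A_basis_factor(2)[OF M that] st by (intro relabel_cong) blast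
    then have "image_mset (relabel \<sigma>) M = image_mset (relabel \<tau>) M" by (rule image_mset_cong)
    then show "A_act X \<sigma> (basis_vec M) = (A_act X \<tau> (basis_vec M) :: _ \<Rightarrow>\<^sub>0 'k)" by simp
  qed
qed

lemma twisted_algebra_A:
  "twisted_algebra A_basis A_act A_mult (A_one :: 'x monomial \<Rightarrow>\<^sub>0 'k::field)"
proof (rule twisted_algebra.intro[OF linear_species_A], unfold_locales)
  fix X Y Z :: "'x set" and \<sigma> :: "'x \<Rightarrow> 'x"
  show "linear_on (A_basis X \<times> A_basis Y) (A_basis (X \<union> Y)) (A_mult X Y :: _ \<Rightarrow> ('x monomial \<Rightarrow>\<^sub>0 'k))"
    if "X \<inter> Y = {}"
    unfolding A_mult_def
    by (rule linear_on_lin_ext) (auto intro!: basis_vec_in_fspace A_basis_add[OF _ _ that])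
  show "A_act (X \<union> Y) \<sigma> (A_mult X Y t) = A_mult (\<sigma> ` X) (\<sigma> ` Y) (tensor_map (A_act X \<sigma>) (A_act Y \<sigma>) t)"
    if "t \<in> fspace (A_basis X \<times> A_basis Y)" for t :: "_ \<Rightarrow>\<^sub>0 'k"
    by (rule linear_eq_on_fspace[OF that]; (intro linear_intros)?) auto
  show "A_mult (X \<union> Y) Z (tensor_map (A_mult X Y) id t) = A_mult X (Y \<union> Z) (tensor_map id (A_mult Y Z) (tensor_assoc t))"
    if "t \<in> fspace ((A_basis X \<times> A_basis Y) \<times> A_basis Z)" for t :: "_ \<Rightarrow>\<^sub>0 'k"
    by (rule linear_eq_on_fspace[OF that]; (intro linear_intros)?) (auto simp: add.assoc)
  show "A_one \<in> (fspace (A_basis {}) :: ('x monomial \<Rightarrow>\<^sub>0 'k) set)"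
    unfolding A_one_def by (rule basis_vec_in_fspace) (simp add: A_basis_empty)
  fix v :: "'x monomial \<Rightarrow>\<^sub>0 'k" assume v: "v \<in> fspace (A_basis X)"
  show "A_mult {} X (A_one \<otimes>\<^sub>v v) = v"
    unfolding A_one_def
    by (rule linear_eq_on_fspace[OF v]; (intro linear_intros)?) (simp del: single_one)
  show "A_mult X {} (v \<otimes>\<^sub>v A_one) = v"
    unfolding A_one_def
    by (rule linear_eq_on_fspace[OF v]; (intro linear_intros)?) (simp del: single_one)
qed

text \<open>
  The counit axioms on monomials: the index set of the coproduct is split as \<open>X = {} \<union> X\<close> or
  \<open>X = X \<union> {}\<close>. With no obstacles all blocks are linked, so the blocks of a factor form a single class.
\<close>

lemma mon_whole:
  assumes M: "M \<in> A_basis X"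
  shows "mon_ideal M X" "mon_restrict M X = M" "mon_ideal_restrict M X = M"
    and "mon_ideal M {}" "mon_restrict M {} = {#}" "mon_ideal_restrict M {} = {#}"
proof -
  have ncp: "\<pi> \<in> indexed_ncp (index_set \<pi>)" "X \<inter> index_set \<pi> = index_set \<pi>" "index_set \<pi> \<noteq> {}"
    if "\<pi> \<in># M" for \<pi>
    using A_basis_factor[OF M that] by (auto simp: indexed_ncp_iff)
  have lk: "linked \<pi> {} x y" for \<pi> :: "'a block_family" and x y by (simp add: linked_def)
  have id: "is_ideal \<pi> (index_set \<pi>)" "is_ideal \<pi> {}" if "\<pi> \<in># M" for \<pi>
    using is_ideal_iff_linked[OF ncp(1)[OF that]] lk by simp_all
  have r: "restrict_mon \<pi> (index_set \<pi>) = {#\<pi>#}" if "\<pi> \<in># M" for \<pi>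
    using ncp[OF that] ncp_restrict_self by (simp add: restrict_mon_def)
  have ir: "ideal_restrict_mon \<pi> (index_set \<pi>) = {#\<pi>#}" if "\<pi> \<in># M" for \<pi>
  proof -
    have "linked_classes \<pi> (index_set \<pi> - index_set \<pi>) (index_set \<pi>) = {index_set \<pi>}"
      using ncp(3)[OF that] lk by (auto simp: linked_classes_def)
    then show ?thesis
      unfolding ideal_restrict_mon_linked_classes[OF ncp(1)[OF that] id(1)[OF that]]
      using ncp_restrict_self[OF ncp(1)[OF that]] by simp
  qed
  have ie: "ideal_restrict_mon \<pi> {} = {#}" if "\<pi> \<in># M" for \<pi>
    unfolding ideal_restrict_mon_linked_classes[OF ncp(1)[OF that] id(2)[OF that]] by simp
  have s: "(\<Sum>\<pi>\<in>#M. {#\<pi>#}) = M" for M :: "'a monomial" by (induction M) simp_all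
  show "mon_ideal M X" "mon_ideal M {}"
    using id ncp(2) by (simp_all add: mon_ideal_def)
  show "mon_restrict M {} = {#}" by (simp add: mon_restrict_def)
  have "image_mset (\<lambda>\<pi>. restrict_mon \<pi> (X \<inter> index_set \<pi>)) M = image_mset (\<lambda>\<pi>. {#\<pi>#}) M"
    using ncp(2) r by (intro image_mset_cong) simp
  then show "mon_restrict M X = M" by (simp add: mon_restrict_def s)
  have "image_mset (\<lambda>\<pi>. ideal_restrict_mon \<pi> (X \<inter> index_set \<pi>)) M = image_mset (\<lambda>\<pi>. {#\<pi>#}) M"
    using ncp(2) ir by (intro image_mset_cong) simp
  then show "mon_ideal_restrict M X = M" by (simp add: mon_ideal_restrict_def s)
  have "image_mset (\<lambda>\<pi>. ideal_restrict_mon \<pi> ({} \<inter> index_set \<pi>)) M = image_mset (\<lambda>\<pi>. {#}) M"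
    using ie by (intro image_mset_cong) simp
  then show "mon_ideal_restrict M {} = {#}" by (simp add: mon_ideal_restrict_def)
qed

text \<open>
  The counit is the coefficient of the empty monomial, the only monomial indexed by the empty set.
\<close>

lemma twisted_coalgebra_A:
  "twisted_coalgebra A_basis A_act A_coprod (\<lambda>v :: 'x monomial \<Rightarrow>\<^sub>0 'k::field. Poly_Mapping.lookup v {#})"
proof (rule twisted_coalgebra.intro[OF linear_species_A], unfold_locales)
  fix X Y Z :: "'x set" and \<sigma> :: "'x \<Rightarrow> 'x" and v :: "'x monomial \<Rightarrow>\<^sub>0 'k"
  let ?e = "\<lambda>v :: 'x monomial \<Rightarrow>\<^sub>0 'k. Poly_Mapping.lookup v {#}"
  show "linear_on (A_basis (X \<union> Y)) (A_basis X \<times> A_basis Y)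
      (A_coprod X Y :: ('x monomial \<Rightarrow>\<^sub>0 'k) \<Rightarrow> _)"
  proof -
    have "linear_on (A_basis (X \<union> Y)) (A_basis X \<times> A_basis Y)
        (lin_ext (\<lambda>M. A_coprod X Y (basis_vec M)) :: ('x monomial \<Rightarrow>\<^sub>0 'k) \<Rightarrow> _)"
    proof (rule linear_on_lin_ext)
      fix M :: "'x monomial" assume M: "M \<in> A_basis (X \<union> Y)"
      show "A_coprod X Y (basis_vec M) \<in> (fspace (A_basis X \<times> A_basis Y) :: (_ \<Rightarrow>\<^sub>0 'k) set)"
        using mon_restrict_in_A_basis[OF M, of X] mon_ideal_restrict_in_A_basis[OF M, of Y]
        by (auto simp: A_coprod_basis intro!: basis_vec_in_fspace)
    qed
    then show ?thesis by (simp add: A_coprod_def)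
  qed
  show "A_coprod (\<sigma> ` X) (\<sigma> ` Y) (A_act (X \<union> Y) \<sigma> v) = tensor_map (A_act X \<sigma>) (A_act Y \<sigma>) (A_coprod X Y v)"
    if "inj_on \<sigma> (X \<union> Y)" "v \<in> fspace (A_basis (X \<union> Y))"
  proof (rule linear_eq_on_fspace[OF that(2)]; (intro linear_intros)?)
    fix M :: "'x monomial" assume M: "M \<in> A_basis (X \<union> Y)"
    show "A_coprod (\<sigma> ` X) (\<sigma> ` Y) (A_act (X \<union> Y) \<sigma> (basis_vec M)) =
        (tensor_map (A_act X \<sigma>) (A_act Y \<sigma>) (A_coprod X Y (basis_vec M)) :: _ \<Rightarrow>\<^sub>0 'k)"
      using mon_relabel[OF that(1) A_basis_factor(2)[OF M]] by (simp add: A_coprod_basis)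
  qed
  show "tensor_assoc (tensor_map (A_coprod X Y) id (A_coprod (X \<union> Y) Z v)) =
      tensor_map id (A_coprod Y Z) (A_coprod X (Y \<union> Z) v)"
    if "X \<inter> Y = {}" "X \<inter> Z = {}" "Y \<inter> Z = {}" "v \<in> fspace (A_basis (X \<union> Y \<union> Z))"
  proof (rule linear_eq_on_fspace[OF that(4)]; (intro linear_intros)?)
    fix M :: "'x monomial" assume M: "M \<in> A_basis (X \<union> Y \<union> Z)"
    show "tensor_assoc (tensor_map (A_coprod X Y) id (A_coprod (X \<union> Y) Z (basis_vec M))) =
        (tensor_map id (A_coprod Y Z) (A_coprod X (Y \<union> Z) (basis_vec M)) :: _ \<Rightarrow>\<^sub>0 'k)"
    proof (cases "mon_ideal M Z \<and> mon_ideal (mon_restrict M (X \<union> Y)) Y")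
      case True
      then show ?thesis using mon_coassoc[OF M that(1-3)] by (simp add: A_coprod_basis)
    next
      case False
      then have "\<not> (mon_ideal M (Y \<union> Z) \<and> mon_ideal (mon_ideal_restrict M (Y \<union> Z)) Z)"
        using mon_coassoc(1)[OF M that(1-3)] by blast
      with False show ?thesis by (auto simp: A_coprod_basis)
    qed
  qed
  show "linear_form_on (A_basis {}) ?e"
    by (simp add: linear_form_on_def lookup_add)
  assume v: "v \<in> fspace (A_basis X)"
  show "form_tensor_id ?e (A_coprod {} X v) = v"
    by (rule linear_eq_on_fspace[OF v]; (intro linear_intros)?)
      (simp add: A_coprod_basis mon_whole form_tensor_id_def)
  show "id_tensor_form ?e (A_coprod X {} v) = v"
    by (rule linear_eq_on_fspace[OF v]; (intro linear_intros)?)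
      (simp add: A_coprod_basis mon_whole id_tensor_form_def)
qed

theorem proposition2p6:
  "\<exists>\<epsilon> :: ('x monomial \<Rightarrow>\<^sub>0 'k::field_char_0) \<Rightarrow> 'k.
     twisted_bialgebra A_basis A_act A_mult A_one A_coprod \<epsilon>"
proof
  let ?e = "\<lambda>v :: 'x monomial \<Rightarrow>\<^sub>0 'k. Poly_Mapping.lookup v {#}"
  show "twisted_bialgebra A_basis A_act A_mult A_one A_coprod ?e"
  proof (rule twisted_bialgebra.intro[OF twisted_algebra_A twisted_coalgebra_A], unfold_locales)
    fix X1 X2 Y1 Y2 :: "'x set" and t :: "'x monomial \<times> 'x monomial \<Rightarrow>\<^sub>0 'k"
    assume t: "t \<in> fspace (A_basis X1 \<times> A_basis X2)"
    show "A_coprod Y1 Y2 (A_mult X1 X2 t) =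
      tensor_map (A_mult (X1 \<inter> Y1) (X2 \<inter> Y1)) (A_mult (X1 \<inter> Y2) (X2 \<inter> Y2))
        (tensor_middle_flip
          (tensor_map (A_coprod (X1 \<inter> Y1) (X1 \<inter> Y2)) (A_coprod (X2 \<inter> Y1) (X2 \<inter> Y2)) t))"
    proof (rule linear_eq_on_fspace[OF t]; (intro linear_intros)?)
      fix p :: "'x monomial \<times> 'x monomial" assume "p \<in> A_basis X1 \<times> A_basis X2"
      then obtain M N where p: "p = (M, N)" and M: "M \<in> A_basis X1" and N: "N \<in> A_basis X2" by blast
      note * = mon_Int[OF A_basis_factor(2)[OF M]] mon_Int[OF A_basis_factor(2)[OF N]]
      show "A_coprod Y1 Y2 (A_mult X1 X2 (basis_vec p)) =
        (tensor_map (A_mult (X1 \<inter> Y1) (X2 \<inter> Y1)) (A_mult (X1 \<inter> Y2) (X2 \<inter> Y2))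
          (tensor_middle_flip
            (tensor_map (A_coprod (X1 \<inter> Y1) (X1 \<inter> Y2)) (A_coprod (X2 \<inter> Y1) (X2 \<inter> Y2))
              (basis_vec p))) :: _ \<Rightarrow>\<^sub>0 'k)"
        unfolding p Int_commute[of X1] Int_commute[of X2] by (simp add: A_coprod_basis *)
    qed
  next
    fix u v :: "'x monomial \<Rightarrow>\<^sub>0 'k"
    assume uv: "u \<in> fspace (A_basis {})" "v \<in> fspace (A_basis {})"
    have scalar: "Poly_Mapping.lookup w M = (if M = {#} then ?e w else 0)"
      if "w \<in> fspace (A_basis {})" for w M
      using that by (auto simp: fspace_def A_basis_empty in_keys_iff subset_iff)
    have "u \<otimes>\<^sub>v v = fscale (?e u * ?e v) (basis_vec ({#}, {#}))"
    proof (rule poly_mapping_eqI)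
      fix p :: "'x monomial \<times> 'x monomial"
      obtain M N where p: "p = (M, N)" by (cases p)
      show "Poly_Mapping.lookup (u \<otimes>\<^sub>v v) p =
          Poly_Mapping.lookup (fscale (?e u * ?e v) (basis_vec ({#}, {#}))) p"
        using scalar[OF uv(1), of M] scalar[OF uv(2), of N]
        unfolding p by (simp add: lookup_single when_def)
    qed
    then have "A_mult {} {} (u \<otimes>\<^sub>v v) = fscale (?e u * ?e v) (A_mult {} {} (basis_vec ({#}, {#})))"
      by (simp only: A_mult_def lin_ext_scale)
    then show "?e (A_mult {} {} (u \<otimes>\<^sub>v v)) = ?e u * ?e v" by simp
  next
    show "A_coprod {} {} A_one = (A_one \<otimes>\<^sub>v A_one :: _ \<Rightarrow>\<^sub>0 'k)"
      by (simp add: A_one_def A_coprod_basis del: single_one)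
    show "?e A_one = 1" by (simp add: A_one_def)
  qed
qed

end
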